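(* Let $\mathcal{L}$ be the nonlocal double phase operator $$\mathcal{L}u(x)=\mathrm{P.V.}\int_{\mathbb{R}^n}|u(x)-u(x+y)|^{p-2}(u(x)-u(x+y))K_{sp}(x,y)\,dy+\mathrm{P.V.}\int_{\mathbb{R}^n}a(x,y)|u(x)-u(x+y)|^{q-2}(u(x)-u(x+y))K_{tq}(x,y)\,dy,$$ where $K_{sp},K_{tq},s,t,p,q,a,\Lambda,M$ satisfy the structural assumptions (i)--(iv) listed in the context. Let $f:B_2\to\mathbb{R}$ be bounded (i.e. $f\in L^\infty(B_2)$). If $u:\mathbb{R}^n\to\mathbb{R}$ is a bounded viscosity solution to $$\mathcal{L}u=f\quad\text{in } B_2$$ with finite nonlocal double phase energy, that is $$\int_{\mathbb{R}^n}\int_{\mathbb{R}^n}\left(\frac{|u(x)-u(x+y)|^p}{|y|^{n+sp}}+a(x,y)\frac{|u(x)-u(x+y)|^q}{|y|^{n+tq}}\right)dx\,dy<\infty ,$$ then $u\in C^{0,\gamma}(B_1)$ for some $\gamma\in(0,1)$ depending only on $n,p,q,s,t,M,\Lambda,\|u\|_{L^\infty(\mathbb{R}^n)},\|f\|_{L^\infty(B_2)}$.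
   Context: $B_\varrho(x_0)\subset\mathbb{R}^n$ is the ball of radius $\varrho$ centered at $x_0$, and $B_\varrho=B_\varrho(0)$. P.V. denotes the principal value, i.e. $\lim_{\varepsilon\to0^+}\int_{\mathbb{R}^n\setminus B_\varepsilon(0)}$. Structural assumptions. (i) $K_{sp},K_{tq}:\mathbb{R}^n\times\mathbb{R}^n\to(0,\infty)$ are measurable and there is $\Lambda>0$ with $\Lambda^{-1}|y|^{-n-sp}\le K_{sp}(x,y)\le\Lambda|y|^{-n-sp}$, $K_{sp}(x,y)=K_{sp}(x,-y)$, $\Lambda^{-1}|y|^{-n-tq}\le K_{tq}(x,y)\le\Lambda|y|^{-n-tq}$, $K_{tq}(x,y)=K_{tq}(x,-y)$. (ii) $s,t\in(0,1)$, $p,q>1$, with $p>\frac1{1-s}$ if $p<2$, and $q>\frac1{1-t}$ (for every value of $q$). (iii) $1\le\frac qp\le\min\{\frac st,1+s\}$. (iv) $a:\mathbb{R}^n\times\mathbb{R}^n\to\mathbb{R}$ is measurable and $0\le a(x,y)\le M$ for every $x\in\mathbb{R}^n$ and a.e. $y\in\mathbb{R}^n$. Viscosity solutions. Let $\Omega\subset\mathbb{R}^n$ be open. A function $u:\mathbb{R}^n\to\mathbb{R}$, upper semicontinuous in $\Omega$ and in $L^\infty_{\rm loc}(\Omega)$, is a viscosity subsolution of $\mathcal{L}u=f$ in $\Omega$ if, whenever $x_0\in\Omega$, $\varrho>0$, $B_\varrho(x_0)\Subset\Omega$ and $\varphi\in C^2(B_\varrho(x_0))$ are such that $\varphi(x_0)=u(x_0)$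 and $\varphi\ge u$ in $B_\varrho(x_0)$, then $\mathcal{L}\varphi_\varrho(x_0)\le f(x_0)$, where $\varphi_\varrho=\varphi$ in $B_\varrho(x_0)$ and $\varphi_\varrho=u$ in $\mathbb{R}^n\setminus B_\varrho(x_0)$. Viscosity supersolutions are defined analogously (lower semicontinuous $u$, $\varphi\le u$ in $B_\varrho(x_0)$, $\mathcal{L}\varphi_\varrho(x_0)\ge f(x_0)$). A viscosity solution is a function that is both a viscosity subsolution and a viscosity supersolution. *)

theory Defs
  imports "HOL-Analysis.Analysis" "HOL-Probability.Essential_Supremum"
begin

text \<open>
  Measurability is Lebesgue measurability, jointly on the product and also for every section
  \<open>y \<mapsto> k x y\<close>. The latter does not follow from the former, and the operator below, which is
  evaluated at individual points \<open>x\<close>, needs it. Every Borel \<open>k\<close> satisfies both conditions.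
\<close>

definition kernel_measurable ::
  "('a::euclidean_space \<Rightarrow> 'a \<Rightarrow> real) \<Rightarrow> bool" where
  "kernel_measurable k \<longleftrightarrow>
     case_prod k \<in> borel_measurable lebesgue \<and>
     (\<forall>x. k x \<in> borel_measurable lebesgue)"

text \<open>
  The parameter \<open>\<sigma>\<close> stands for \<open>s p\<close> or \<open>t q\<close>. The two-sided bound is stated for \<open>y \<noteq> 0\<close>: at the
  origin the power is infinite on paper, whereas \<open>0 powr r = 0\<close> here.
\<close>

definition admissible_kernel ::
  "real \<Rightarrow> real \<Rightarrow> ((real^'n) \<Rightarrow> (real^'n) \<Rightarrow> real) \<Rightarrow> bool" where
  "admissible_kernel \<Lambda> \<sigma> K \<longleftrightarrow>
     kernel_measurable K \<and>
     (\<forall>x y. K x y > 0) \<and>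
     (\<forall>x y. y \<noteq> 0 \<longrightarrow>
        inverse \<Lambda> * norm y powr (- real CARD('n) - \<sigma>) \<le> K x y \<and>
        K x y \<le> \<Lambda> * norm y powr (- real CARD('n) - \<sigma>)) \<and>
     (\<forall>x y. K x y = K x (- y))"

definition admissible_coefficient ::
  "real \<Rightarrow> ((real^'n) \<Rightarrow> (real^'n) \<Rightarrow> real) \<Rightarrow> bool" where
  "admissible_coefficient M a \<longleftrightarrow>
     kernel_measurable a \<and>
     (\<forall>x. AE y in lebesgue. 0 \<le> a x y \<and> a x y \<le> M)"

text \<open>
  Integrals of real functions with values in the extended reals. The Bochner integral would not
  do: a test function of class \<open>C\<^sup>2\<close> on an open ball may blow up at the boundary, so that the
  operator takes the value \<open>-\<infinity>\<close> or \<open>\<infinity>\<close>, and there the Bochner integral has the value 0.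
\<close>

definition extended_integral ::
  "'a::euclidean_space set \<Rightarrow> ('a \<Rightarrow> real) \<Rightarrow> ereal" where
  "extended_integral S g =
     enn2ereal (\<integral>\<^sup>+ y\<in>S. ennreal (g y) \<partial>lebesgue) -
     enn2ereal (\<integral>\<^sup>+ y\<in>S. ennreal (- g y) \<partial>lebesgue)"

definition pv_integral :: "('a::euclidean_space \<Rightarrow> real) \<Rightarrow> ereal" where
  "pv_integral g = Lim (at_right 0) (\<lambda>\<epsilon>. extended_integral (- ball 0 \<epsilon>) g)"

definition signed_power :: "real \<Rightarrow> real \<Rightarrow> real" where
  "signed_power r d = \<bar>d\<bar> powr (r - 2) * d"

definition double_phase_operator ::
  "real \<Rightarrow> real \<Rightarrow> ((real^'n) \<Rightarrow> (real^'n) \<Rightarrow> real) \<Rightarrow> ((real^'n) \<Rightarrow> (real^'n) \<Rightarrow> real) \<Rightarrow>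
   ((real^'n) \<Rightarrow> (real^'n) \<Rightarrow> real) \<Rightarrow> ((real^'n) \<Rightarrow> real) \<Rightarrow> (real^'n) \<Rightarrow> ereal" where
  "double_phase_operator p q Ksp Ktq a u x =
     pv_integral (\<lambda>y. signed_power p (u x - u (x + y)) * Ksp x y) +
     pv_integral (\<lambda>y. a x y * signed_power q (u x - u (x + y)) * Ktq x y)"

definition finite_double_phase_energy ::
  "real \<Rightarrow> real \<Rightarrow> real \<Rightarrow> real \<Rightarrow> ((real^'n) \<Rightarrow> (real^'n) \<Rightarrow> real) \<Rightarrow>
   ((real^'n) \<Rightarrow> real) \<Rightarrow> bool" where
  "finite_double_phase_energy p q s t a u \<longleftrightarrow>
     (\<integral>\<^sup>+ y. (\<integral>\<^sup>+ x.
        ennreal (\<bar>u x - u (x + y)\<bar> powr p / norm y powr (real CARD('n) + s * p) +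
                 a x y * (\<bar>u x - u (x + y)\<bar> powr q / norm y powr (real CARD('n) + t * q)))
        \<partial>lebesgue) \<partial>lebesgue) < \<infinity>"

definition Linf_norm :: "'a::euclidean_space set \<Rightarrow> ('a \<Rightarrow> real) \<Rightarrow> ereal" where
  "Linf_norm S g = esssup (lebesgue_on S) (\<lambda>x. ereal \<bar>g x\<bar>)"

definition locally_Linf :: "'a::euclidean_space set \<Rightarrow> ('a \<Rightarrow> real) \<Rightarrow> bool" where
  "locally_Linf \<Omega> u \<longleftrightarrow>
     u \<in> borel_measurable (lebesgue_on \<Omega>) \<and>
     (\<forall>C. compact C \<and> C \<subseteq> \<Omega> \<longrightarrow> (\<exists>B. AE x in lebesgue_on C. \<bar>u x\<bar> \<le> B))"

definition usc_on :: "'a::topological_space set \<Rightarrow> ('a \<Rightarrow> real) \<Rightarrow> bool" where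
  "usc_on \<Omega> u \<longleftrightarrow> (\<forall>x\<in>\<Omega>. \<forall>c>u x. \<forall>\<^sub>F z in at x within \<Omega>. u z < c)"

definition lsc_on :: "'a::topological_space set \<Rightarrow> ('a \<Rightarrow> real) \<Rightarrow> bool" where
  "lsc_on \<Omega> u \<longleftrightarrow> (\<forall>x\<in>\<Omega>. \<forall>c<u x. \<forall>\<^sub>F z in at x within \<Omega>. c < u z)"

definition C2_on :: "'a::euclidean_space set \<Rightarrow> ('a \<Rightarrow> real) \<Rightarrow> bool" where
  "C2_on S \<phi> \<longleftrightarrow>
     (\<exists>(D :: 'a \<Rightarrow> 'a \<Rightarrow>\<^sub>L real) (D2 :: 'a \<Rightarrow> 'a \<Rightarrow>\<^sub>L ('a \<Rightarrow>\<^sub>L real)).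
        (\<forall>x\<in>S. (\<phi> has_derivative blinfun_apply (D x)) (at x)) \<and>
        (\<forall>x\<in>S. (D has_derivative blinfun_apply (D2 x)) (at x)) \<and>
        continuous_on S D2)"

definition holder_on :: "real \<Rightarrow> 'a::metric_space set \<Rightarrow> ('a \<Rightarrow> real) \<Rightarrow> bool" where
  "holder_on \<gamma> S u \<longleftrightarrow> (\<exists>C. \<forall>x\<in>S. \<forall>y\<in>S. \<bar>u x - u y\<bar> \<le> C * dist x y powr \<gamma>)"

definition glue :: "'a::metric_space \<Rightarrow> real \<Rightarrow> ('a \<Rightarrow> real) \<Rightarrow> ('a \<Rightarrow> real) \<Rightarrow> 'a \<Rightarrow> real" where
  "glue x0 \<rho> \<phi> u = (\<lambda>x. if x \<in> ball x0 \<rho> then \<phi> x else u x)"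

definition viscosity_subsolution ::
  "(('a::euclidean_space \<Rightarrow> real) \<Rightarrow> 'a \<Rightarrow> ereal) \<Rightarrow> 'a set \<Rightarrow> ('a \<Rightarrow> real) \<Rightarrow> ('a \<Rightarrow> real) \<Rightarrow> bool"
  where
  "viscosity_subsolution L \<Omega> f u \<longleftrightarrow>
     usc_on \<Omega> u \<and> locally_Linf \<Omega> u \<and>
     (\<forall>x0\<in>\<Omega>. \<forall>\<rho>>0. \<forall>\<phi>.
        closure (ball x0 \<rho>) \<subseteq> \<Omega> \<and> C2_on (ball x0 \<rho>) \<phi> \<and>
        \<phi> x0 = u x0 \<and> (\<forall>x\<in>ball x0 \<rho>. u x \<le> \<phi> x)
        \<longrightarrow> L (glue x0 \<rho> \<phi> u) x0 \<le> ereal (f x0))"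

definition viscosity_supersolution ::
  "(('a::euclidean_space \<Rightarrow> real) \<Rightarrow> 'a \<Rightarrow> ereal) \<Rightarrow> 'a set \<Rightarrow> ('a \<Rightarrow> real) \<Rightarrow> ('a \<Rightarrow> real) \<Rightarrow> bool"
  where
  "viscosity_supersolution L \<Omega> f u \<longleftrightarrow>
     lsc_on \<Omega> u \<and> locally_Linf \<Omega> u \<and>
     (\<forall>x0\<in>\<Omega>. \<forall>\<rho>>0. \<forall>\<phi>.
        closure (ball x0 \<rho>) \<subseteq> \<Omega> \<and> C2_on (ball x0 \<rho>) \<phi> \<and>
        \<phi> x0 = u x0 \<and> (\<forall>x\<in>ball x0 \<rho>. \<phi> x \<le> u x)
        \<longrightarrow> L (glue x0 \<rho> \<phi> u) x0 \<ge> ereal (f x0))"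

definition viscosity_solution ::
  "(('a::euclidean_space \<Rightarrow> real) \<Rightarrow> 'a \<Rightarrow> ereal) \<Rightarrow> 'a set \<Rightarrow> ('a \<Rightarrow> real) \<Rightarrow> ('a \<Rightarrow> real) \<Rightarrow> bool"
  where
  "viscosity_solution L \<Omega> f u \<longleftrightarrow>
     viscosity_subsolution L \<Omega> f u \<and> viscosity_supersolution L \<Omega> f u"

end

theory Submission
  imports Defs
begin

text \<open>
  The proof is Silvestre's oscillation argument, run at every scale without rescaling the equation.
  Fix \<open>x0\<close> in the unit ball, a scale \<open>r\<close> and an amplitude \<open>\<omega>\<close>, and suppose that \<open>u \<le> m + \<omega>\<close> in
  \<open>ball x0 r\<close>, that \<open>u\<close> grows slowly outside, and that \<open>u \<le> m\<close> on half of the ball. If \<open>u\<close> came close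
  to \<open>m + \<omega>\<close> somewhere in the ball of half the radius, a flat paraboloid, of height \<open>\<kappa> \<omega>\<close> over the
  ball, would touch \<open>u\<close> from above at some \<open>x1\<close>. There the operator, applied to the paraboloid
  near \<open>x1\<close> and to \<open>u\<close> elsewhere, is the sum of

    \<^item> a positive contribution of order \<open>\<omega> powr (p - 1) * r powr (- s p)\<close> of the half of the ball where
      \<open>u\<close> is far below \<open>u x1\<close>;

    \<^item> negative contributions of the paraboloid, of the rest of the ball and of the tail, which carry the
      additional factor \<open>\<delta> powr (p - 1)\<close>, where \<open>\<delta>\<close> is small together with \<open>\<kappa>\<close> and with the growth
      exponent of the tail.

  For small \<open>\<delta>\<close> and small \<open>r\<close> this contradicts the viscosity inequality with a bounded right-hand
  side. So \<open>u\<close> improves its upper bound by a fixed fraction of \<open>\<omega>\<close> (\<open>growth_lemma\<close>); in the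
  complementary case the same holds for \<open>- u\<close> and the lower bound. Iterating over dyadic balls gives
  \<open>oscillation_decay\<close>, and hence Hoelder continuity.

  The structural conditions enter in the estimate of the operator (\<open>one_phase_lower_bound\<close>,
  \<open>double_phase_lower_bound\<close>). Near \<open>x1\<close> the integrand is absolutely integrable when the exponent
  \<open>e\<close> of the phase and the order \<open>\<sigma>\<close> of its kernel satisfy \<open>e - 1 > \<sigma>\<close>; this is what
  \<open>p > 1 / (1 - s)\<close> and \<open>q > 1 / (1 - t)\<close> say. It can fail for the first phase only if \<open>p \<ge> 2\<close>, and then
  the symmetry of the kernel reduces the principal value to second differences. The conditions
  \<open>p \<le> q\<close> and \<open>t q \<le> s p\<close> make the second phase no larger than the first one at small scales.
\<close>

section \<open>Integrals of powers of the norm\<close>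

lemma nn_integral_shell_le:
  fixes R \<beta> :: real
  assumes "R > 0"
  shows "(\<integral>\<^sup>+ y\<in>(ball 0 (2*R) - ball 0 R). ennreal (norm (y::'a::euclidean_space) powr (\<beta> - DIM('a))) \<partial>lebesgue)
    \<le> ennreal (measure lebesgue (ball (0::'a) 1) * 2 powr (DIM('a) + \<bar>\<beta>\<bar>) * R powr \<beta>)"
proof -
  let ?V = "measure lebesgue (ball (0::'a) 1)"
  have pt: "norm y powr (\<beta> - DIM('a)) \<le> 2 powr \<bar>\<beta>\<bar> * R powr \<beta> * R powr (- real DIM('a))"
    if "R \<le> norm y" "norm y < 2 * R" for y :: 'a
  proof -
    have y0: "norm y > 0" using that assms by linarith
    have "norm y powr \<beta> \<le> 2 powr \<bar>\<beta>\<bar> * R powr \<beta>"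
    proof (cases "\<beta> \<ge> 0")
      case True
      have "norm y powr \<beta> \<le> (2*R) powr \<beta>" using that True y0 by (intro powr_mono2) auto
      then show ?thesis using True assms by (simp add: powr_mult)
    next
      case False
      have "norm y powr \<beta> \<le> R powr \<beta>" using that False assms by (intro powr_mono2') auto
      moreover have "1 \<le> 2 powr \<bar>\<beta>\<bar>" by (simp add: ge_one_powr_ge_zero)
      then have "1 * R powr \<beta> \<le> 2 powr \<bar>\<beta>\<bar> * R powr \<beta>" by (intro mult_right_mono) auto
      ultimately show ?thesis by linarith
    qed
    moreover have "norm y powr (- real DIM('a)) \<le> R powr (- real DIM('a))"
      using that assms by (intro powr_mono2') auto
    ultimately have "norm y powr \<beta> * norm y powr (- real DIM('a))
       \<le> 2 powr \<bar>\<beta>\<bar> * R powr \<beta> * R powr (- real DIM('a))"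
      by (intro mult_mono) auto
    then show ?thesis using y0 by (simp flip: powr_add)
  qed
  have "(\<integral>\<^sup>+ y\<in>(ball 0 (2*R) - ball 0 R). ennreal (norm (y::'a) powr (\<beta> - DIM('a))) \<partial>lebesgue)
    \<le> (\<integral>\<^sup>+ y. ennreal (2 powr \<bar>\<beta>\<bar> * R powr \<beta> * R powr (- real DIM('a))) * indicator (ball (0::'a) (2*R)) y \<partial>lebesgue)"
    using pt by (intro nn_integral_mono) (auto simp: indicator_def intro!: ennreal_leI)
  also have "\<dots> = ennreal (2 powr \<bar>\<beta>\<bar> * R powr \<beta> * R powr (- real DIM('a))) * emeasure lebesgue (ball (0::'a) (2*R))"
    by (subst nn_integral_cmult_indicator) auto
  also have "emeasure lebesgue (ball (0::'a) (2*R)) = ennreal ((2*R) ^ DIM('a) * ?V)"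
    using assms by (simp add: emeasure_eq_measure2 content_ball_conv_unit_ball[of "2*R" "0::'a"] emeasure_lborel_ball_finite)
  also have "ennreal (2 powr \<bar>\<beta>\<bar> * R powr \<beta> * R powr (- real DIM('a))) * \<dots> =
     ennreal (?V * 2 powr (DIM('a) + \<bar>\<beta>\<bar>) * R powr \<beta>)"
  proof -
    have "R powr (- real DIM('a)) * R ^ DIM('a) = 1"
      using assms by (simp add: powr_minus powr_realpow)
    then have "2 powr \<bar>\<beta>\<bar> * R powr \<beta> * ((R powr (- real DIM('a)) * R ^ DIM('a)) * (2 ^ DIM('a) * ?V))
       = ?V * 2 powr (DIM('a) + \<bar>\<beta>\<bar>) * R powr \<beta>"
      by (simp add: powr_add powr_realpow)
    then have "2 powr \<bar>\<beta>\<bar> * R powr \<beta> * R powr (- real DIM('a)) * ((2*R) ^ DIM('a) * ?V)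
       = ?V * 2 powr (DIM('a) + \<bar>\<beta>\<bar>) * R powr \<beta>"
      by (simp only: power_mult_distrib mult_ac)
    then show ?thesis using assms by (subst ennreal_mult[symmetric]) (auto simp del: measure_completion)
  qed
  finally show ?thesis .
qed

text \<open>
  On the shell of radius \<open>\<rho>\<close> the integral of \<open>norm y powr (\<beta> - DIM('a))\<close> is of the order \<open>\<rho> powr \<beta>\<close>,
  so the shells form a geometric series. Its ratio is below 1 for \<open>c = 2\<close> if \<open>\<beta> < 0\<close> (integrals over
  complements of balls) and for \<open>c = 1/2\<close> if \<open>\<beta> > 0\<close> (integrals over balls).
\<close>

lemma nn_integral_dyadic_le:
  fixes R \<beta> c x :: real and S :: "'a::euclidean_space set"
  assumes "R > 0" "c > 0" "c powr \<beta> < 1"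
    and S: "S \<subseteq> (\<Union>k::nat. ball 0 (2 * (R * c ^ k)) - ball 0 (R * c ^ k))"
  shows "(\<integral>\<^sup>+ y\<in>S. ennreal (norm y powr (\<beta> - DIM('a))) \<partial>lebesgue)
    \<le> ennreal (measure lebesgue (ball (0::'a) 1) * 2 powr (DIM('a) + \<bar>\<beta>\<bar>) / (1 - c powr \<beta>) * R powr \<beta>)"
proof -
  let ?A = "\<lambda>k::nat. ball (0::'a) (2 * (R * c ^ k)) - ball 0 (R * c ^ k)"
  let ?f = "\<lambda>y::'a. ennreal (norm y powr (\<beta> - DIM('a)))"
  let ?K = "measure lebesgue (ball (0::'a) 1) * 2 powr (DIM('a) + \<bar>\<beta>\<bar>)"
  have m: "?f \<in> borel_measurable lebesgue"
    by (intro measurable_completion) auto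
  have "(\<integral>\<^sup>+ y\<in>S. ?f y \<partial>lebesgue) \<le> (\<integral>\<^sup>+ y. (\<Sum>k. ?f y * indicator (?A k) y) \<partial>lebesgue)"
  proof (intro nn_integral_mono)
    fix y :: 'a
    show "?f y * indicator S y \<le> (\<Sum>k. ?f y * indicator (?A k) y)"
    proof (cases "y \<in> S")
      case True
      then obtain k where k: "y \<in> ?A k" using S by blast
      have "?f y * indicator S y = (\<Sum>j\<in>{k}. ?f y * indicator (?A j) y)" using k True by simp
      also have "\<dots> \<le> (\<Sum>k. ?f y * indicator (?A k) y)" by (intro sum_le_suminf) auto
      finally show ?thesis .
    qed auto
  qed
  also have "\<dots> = (\<Sum>k. \<integral>\<^sup>+ y. ?f y * indicator (?A k) y \<partial>lebesgue)"
    by (intro nn_integral_suminf borel_measurable_times_ennreal m borel_measurable_indicator) auto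
  also have "\<dots> \<le> (\<Sum>k. ennreal (?K * R powr \<beta> * (c powr \<beta>) ^ k))"
  proof (intro suminf_le allI)
    fix k :: nat
    have "(\<integral>\<^sup>+ y. ?f y * indicator (?A k) y \<partial>lebesgue) \<le> ennreal (?K * (R * c ^ k) powr \<beta>)"
      using nn_integral_shell_le[of "R * c^k" \<beta>, where 'a='a] assms by simp
    also have "?K * (R * c ^ k) powr \<beta> = ?K * R powr \<beta> * (c powr \<beta>) ^ k"
      using assms by (simp add: powr_mult powr_power powr_realpow[symmetric] powr_powr mult.commute)
    finally show "(\<integral>\<^sup>+ y. ?f y * indicator (?A k) y \<partial>lebesgue) \<le> ennreal (?K * R powr \<beta> * (c powr \<beta>) ^ k)" .
  qed auto
  also have "\<dots> = ennreal (?K * R powr \<beta> * (1 / (1 - c powr \<beta>)))"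
    using assms by (intro suminf_ennreal_eq sums_mult geometric_sums) auto
  finally show ?thesis by (simp add: mult_ac)
qed

lemma ball_complement_dyadic:
  assumes "\<rho> > 0"
  shows "- ball (0::'a::euclidean_space) \<rho> \<subseteq> (\<Union>k::nat. ball 0 (2 * (\<rho> * 2 ^ k)) - ball 0 (\<rho> * 2 ^ k))"
proof
  fix y :: 'a assume "y \<in> - ball 0 \<rho>"
  then have y: "norm y \<ge> \<rho>" by simp
  define L where "L = (LEAST k::nat. norm y < \<rho> * 2 ^ k)"
  have "\<exists>k::nat. norm y / \<rho> < 2 ^ k" using real_arch_pow[of 2 "norm y / \<rho>"] by auto
  then have ex: "\<exists>k::nat. norm y < \<rho> * 2 ^ k" using assms by (auto simp: field_simps)
  have L: "norm y < \<rho> * 2 ^ L" unfolding L_def using ex by (rule LeastI_ex)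
  have "L \<noteq> 0" using L y by (metis mult.right_neutral not_less power_0)
  then obtain k where k: "L = Suc k" using not0_implies_Suc by blast
  have "\<not> norm y < \<rho> * 2 ^ k" using not_less_Least[of k "\<lambda>k. norm y < \<rho> * 2 ^ k"] k L_def by auto
  with L k show "y \<in> (\<Union>k::nat. ball 0 (2 * (\<rho> * 2 ^ k)) - ball 0 (\<rho> * 2 ^ k))"
    by (auto intro!: exI[of _ k] simp: mult_ac)
qed

lemma punctured_ball_dyadic:
  assumes "\<rho> > 0"
  shows "ball (0::'a::euclidean_space) \<rho> - {0} \<subseteq> (\<Union>k::nat. ball 0 (2 * ((\<rho>/2) * (1/2) ^ k)) - ball 0 ((\<rho>/2) * (1/2) ^ k))"
proof
  fix y :: 'a assume "y \<in> ball 0 \<rho> - {0}"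
  then have y: "norm y < \<rho>" "norm y > 0" by auto
  define L where "L = (LEAST k::nat. \<rho> * (1/2) ^ k \<le> norm y)"
  have "0 < norm y / \<rho>" using assms y(2) by (rule divide_pos_pos[rotated])
  then have "\<exists>k::nat. (1/2) ^ k < norm y / \<rho>" by (intro real_arch_pow_inv) auto
  then have ex: "\<exists>k::nat. \<rho> * (1/2) ^ k \<le> norm y" using assms by (auto simp: field_simps intro: less_imp_le)
  have L: "\<rho> * (1/2) ^ L \<le> norm y" unfolding L_def using ex by (rule LeastI_ex)
  have "L \<noteq> 0" using L y by (metis mult.right_neutral not_less power_0)
  then obtain k where k: "L = Suc k" using not0_implies_Suc by blast
  have "\<not> \<rho> * (1/2) ^ k \<le> norm y" using not_less_Least[of k "\<lambda>k. \<rho> * (1/2) ^ k \<le> norm y"] k L_def by auto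
  with L k show "y \<in> (\<Union>k::nat. ball 0 (2 * ((\<rho>/2) * (1/2) ^ k)) - ball 0 ((\<rho>/2) * (1/2) ^ k))"
    by (auto intro!: exI[of _ k] simp: mult_ac)
qed

lemma set_integral_from_nn_bound:
  fixes f :: "'a::euclidean_space \<Rightarrow> real"
  assumes f: "f \<in> borel_measurable lebesgue" "\<And>y. 0 \<le> f y" and S: "S \<in> sets lebesgue"
    and b: "(\<integral>\<^sup>+ y\<in>S. ennreal (f y) \<partial>lebesgue) \<le> ennreal C" "0 \<le> C"
  shows "set_integrable lebesgue S f" "(LINT y:S|lebesgue. f y) \<le> C"
proof -
  have eq: "(\<integral>\<^sup>+ y. ennreal (indicator S y * f y) \<partial>lebesgue) = (\<integral>\<^sup>+ y\<in>S. ennreal (f y) \<partial>lebesgue)"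
    by (intro nn_integral_cong) (auto simp: indicator_def)
  have i: "integrable lebesgue (\<lambda>y. indicator S y * f y)"
    using f S b eq by (intro integrableI_nonneg) (auto simp: le_less_trans ennreal_less_top)
  then show "set_integrable lebesgue S f" by (simp add: set_integrable_def)
  show "(LINT y:S|lebesgue. f y) \<le> C"
    unfolding set_lebesgue_integral_def real_scaleR_def
    using integral_real_bounded[of C lebesgue "\<lambda>y. indicator S y * f y"] b eq by auto
qed

lemma radial_integral_outside_ball:
  fixes \<sigma> :: real
  assumes "\<sigma> > 0"
  obtains C where "C > 0"
    "\<And>\<rho>. \<rho> > 0 \<Longrightarrow> set_integrable lebesgue (- ball (0::'a::euclidean_space) \<rho>) (\<lambda>y. norm y powr (- real DIM('a) - \<sigma>))"
    "\<And>\<rho>. \<rho> > 0 \<Longrightarrow> (LINT y:(- ball (0::'a) \<rho>)|lebesgue. norm y powr (- real DIM('a) - \<sigma>)) \<le> C * \<rho> powr (- \<sigma>)"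
proof -
  let ?C = "measure lebesgue (ball (0::'a) 1) * 2 powr (DIM('a) + \<bar>-\<sigma>\<bar>) / (1 - 2 powr (-\<sigma>))"
  have *: "2 powr (-\<sigma>) < (1::real)" using assms by (simp add: powr_less_one)
  have C: "?C > 0" using * by (auto intro!: divide_pos_pos mult_pos_pos content_ball_pos)
  have m: "(\<lambda>y::'a. norm y powr (- real DIM('a) - \<sigma>)) \<in> borel_measurable lebesgue"
    by (intro measurable_completion) auto
  have "(\<integral>\<^sup>+ y\<in>(- ball (0::'a) \<rho>). ennreal (norm y powr (- real DIM('a) - \<sigma>)) \<partial>lebesgue) \<le> ennreal (?C * \<rho> powr (- \<sigma>))"
    if "\<rho> > 0" for \<rho>
    using nn_integral_dyadic_le[OF that _ * ball_complement_dyadic[OF that], where 'a='a]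
    unfolding minus_real_def by (simp add: add.commute)
  note b = set_integral_from_nn_bound[OF m _ _ this]
  show ?thesis
  proof (rule that)
    show "?C > 0" by (fact C)
  qed (use C b in \<open>auto intro!: mult_nonneg_nonneg simp del: times_divide_eq_left\<close>)
qed

lemma radial_integral_ball:
  fixes \<alpha> :: real
  assumes "\<alpha> > 0"
  obtains C where "C > 0"
    "\<And>\<rho>. \<rho> > 0 \<Longrightarrow> set_integrable lebesgue (ball (0::'a::euclidean_space) \<rho>) (\<lambda>y. norm y powr (\<alpha> - real DIM('a)))"
    "\<And>\<rho>. \<rho> > 0 \<Longrightarrow> (LINT y:(ball (0::'a) \<rho>)|lebesgue. norm y powr (\<alpha> - real DIM('a))) \<le> C * \<rho> powr \<alpha>"
proof -
  let ?P = "measure lebesgue (ball (0::'a) 1) * 2 powr (DIM('a) + \<bar>\<alpha>\<bar>) / (1 - (1/2) powr \<alpha>)"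
  let ?C = "?P * (1/2) powr \<alpha>"
  have half: "(\<rho>/2) powr \<alpha> = (1/2) powr \<alpha> * \<rho> powr \<alpha>" if "\<rho> > 0" for \<rho>
    using that powr_mult[of "1/2" \<rho> \<alpha>] by simp
  have *: "(1/2) powr \<alpha> < (1::real)" using assms powr_less_mono2[of \<alpha> "1/2" 1] by simp
  have C: "?C > 0" using * by (auto intro!: divide_pos_pos mult_pos_pos content_ball_pos)
  have m: "(\<lambda>y::'a. norm y powr (\<alpha> - real DIM('a))) \<in> borel_measurable lebesgue"
    by (intro measurable_completion) auto
  have "(\<integral>\<^sup>+ y\<in>(ball (0::'a) \<rho>). ennreal (norm y powr (\<alpha> - real DIM('a))) \<partial>lebesgue) \<le> ennreal (?C * \<rho> powr \<alpha>)"
    if "\<rho> > 0" for \<rho>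
  proof -
    have "(\<integral>\<^sup>+ y\<in>(ball (0::'a) \<rho>). ennreal (norm y powr (\<alpha> - real DIM('a))) \<partial>lebesgue) =
       (\<integral>\<^sup>+ y\<in>(ball (0::'a) \<rho> - {0}). ennreal (norm y powr (\<alpha> - real DIM('a))) \<partial>lebesgue)"
      by (intro nn_integral_cong) (auto simp: indicator_def)
    also have "\<dots> \<le> ennreal (?P * (\<rho>/2) powr \<alpha>)"
      using nn_integral_dyadic_le[OF _ _ * punctured_ball_dyadic[OF that], where 'a='a] that
      by simp
    also have "?P * (\<rho>/2) powr \<alpha> = ?C * \<rho> powr \<alpha>"
      using half[OF that] by simp
    finally show ?thesis .
  qed
  note b = set_integral_from_nn_bound[OF m _ _ this]
  show ?thesis
  proof (rule that)
    show "?C > 0" by (fact C)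
  qed (use C b in \<open>auto intro!: mult_nonneg_nonneg simp del: times_divide_eq_left\<close>)
qed

section \<open>Principal values\<close>

lemma lebesgue_plus:
  fixes x :: "'a::euclidean_space"
  shows "(+) x \<in> lebesgue \<rightarrow>\<^sub>M lebesgue" "distr lebesgue lebesgue ((+) x) = lebesgue"
  using lebesgue_affine_measurable[of "\<lambda>_. 1" x] lebesgue_affine_euclidean[of "\<lambda>_. 1" x]
  by (simp_all add: euclidean_representation density_1)

lemma lebesgue_uminus:
  shows "uminus \<in> lebesgue \<rightarrow>\<^sub>M (lebesgue :: 'a::euclidean_space measure)"
    and "distr lebesgue lebesgue uminus = (lebesgue :: 'a measure)"
  using lebesgue_affine_measurable[of "\<lambda>_. -1" "0::'a"] lebesgue_affine_euclidean[of "\<lambda>_. -1" "0::'a"]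
  by (simp_all add: euclidean_representation density_1 sum_negf fun_Compl_def)

lemma AE_lebesgue_plus:
  assumes "AE z in lebesgue. P z"
  shows "AE y in lebesgue. P (x + y :: 'a::euclidean_space)"
  by (rule AE_distrD[OF lebesgue_plus(1)[of x]]) (simp only: lebesgue_plus(2) assms)

lemma AE_lebesgue_uminus:
  assumes "AE z in lebesgue. P z"
  shows "AE y in lebesgue. P (- y :: 'a::euclidean_space)"
  by (rule AE_distrD[OF lebesgue_uminus(1)]) (simp only: lebesgue_uminus(2) assms)

lemma AE_lebesgue_neq: "AE y in lebesgue. y \<noteq> (c::'a::euclidean_space)"
  by (intro AE_completion AE_lborel_singleton)

lemma set_integral_reflect:
  fixes g :: "'a::euclidean_space \<Rightarrow> real"
  assumes g: "set_integrable lebesgue A g" and A: "\<And>y. - y \<in> A \<longleftrightarrow> y \<in> A"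
  shows "set_integrable lebesgue A (\<lambda>y. g (- y))"
    and "(LINT y:A|lebesgue. g (- y)) = (LINT y:A|lebesgue. g y)"
proof -
  let ?h = "\<lambda>y. indicator A y *\<^sub>R g y"
  have i: "integrable (distr lebesgue lebesgue uminus) ?h"
    using g by (simp add: set_integrable_def lebesgue_uminus(2))
  have m: "?h \<in> borel_measurable lebesgue" using g by (auto simp: set_integrable_def)
  have eq: "?h (- y) = indicator A y *\<^sub>R g (- y)" for y
    using A by (auto simp: indicator_def)
  note eq' = eq[unfolded real_scaleR_def]
  show "set_integrable lebesgue A (\<lambda>y. g (- y))"
    using integrable_distr[OF lebesgue_uminus(1) i] by (simp add: set_integrable_def eq')
  have "integral\<^sup>L lebesgue ?h = (\<integral>y. ?h (- y) \<partial>lebesgue)"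
    using integral_distr[OF lebesgue_uminus(1) m] by (simp add: lebesgue_uminus(2))
  then show "(LINT y:A|lebesgue. g (- y)) = (LINT y:A|lebesgue. g y)"
    by (simp add: set_lebesgue_integral_def eq')
qed

lemma extended_integral_eq_set_integral:
  assumes "set_integrable lebesgue S g"
  shows "extended_integral S g = ereal (LINT y:S|lebesgue. g y)"
proof -
  let ?h = "\<lambda>y. indicator S y * g y"
  have i: "integrable lebesgue ?h" using assms by (simp add: set_integrable_def)
  have e: "(\<integral>\<^sup>+ y\<in>S. ennreal (g y) \<partial>lebesgue) = (\<integral>\<^sup>+ y. ennreal (?h y) \<partial>lebesgue)"
    "(\<integral>\<^sup>+ y\<in>S. ennreal (- g y) \<partial>lebesgue) = (\<integral>\<^sup>+ y. ennreal (- ?h y) \<partial>lebesgue)"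
    by (auto intro!: nn_integral_cong simp: indicator_def)
  have f: "(\<integral>\<^sup>+ y. ennreal (?h y) \<partial>lebesgue) \<noteq> \<infinity>" "(\<integral>\<^sup>+ y. ennreal (- ?h y) \<partial>lebesgue) \<noteq> \<infinity>"
    using i by (auto simp: real_integrable_def)
  have er: "enn2ereal z = ereal (enn2real z)" if "z \<noteq> \<infinity>" for z
    using that by (cases z) (auto simp: enn2ereal_ennreal)
  show ?thesis
    unfolding extended_integral_def e er[OF f(1)] er[OF f(2)] set_lebesgue_integral_def
    using real_lebesgue_integral_def[OF i] by simp
qed

text \<open>
  \<open>pv_integral\<close> is a \<open>Lim\<close>, hence unspecified where the limit does not exist, and the extended
  integrals in it are not odd in the integrand where they have the form \<open>\<infinity> - \<infinity>\<close>. This predicate records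
  that all quantities involved are finite and that the limit exists.
\<close>

definition has_principal_value :: "('a::euclidean_space \<Rightarrow> real) \<Rightarrow> real \<Rightarrow> bool" where
  "has_principal_value g I \<longleftrightarrow>
     (\<forall>\<epsilon>>0. set_integrable lebesgue (- ball 0 \<epsilon>) g) \<and>
     ((\<lambda>\<epsilon>. LINT y:(- ball 0 \<epsilon>)|lebesgue. g y) \<longlongrightarrow> I) (at_right 0)"

lemma pv_integral_eq:
  assumes "has_principal_value g I"
  shows "pv_integral g = ereal I"
proof -
  have "((\<lambda>\<epsilon>. ereal (LINT y:(- ball 0 \<epsilon>)|lebesgue. g y)) \<longlongrightarrow> ereal I) (at_right 0)"
    using assms by (simp add: has_principal_value_def)
  moreover have "\<forall>\<^sub>F \<epsilon> in at_right 0. ereal (LINT y:(- ball 0 \<epsilon>)|lebesgue. g y) = extended_integral (- ball 0 \<epsilon>) g"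
    using eventually_at_right_less[of 0] by eventually_elim
      (use assms in \<open>auto simp: has_principal_value_def extended_integral_eq_set_integral\<close>)
  ultimately have "((\<lambda>\<epsilon>. extended_integral (- ball 0 \<epsilon>) g) \<longlongrightarrow> ereal I) (at_right 0)"
    by (rule Lim_transform_eventually)
  then show ?thesis unfolding pv_integral_def by (intro tendsto_Lim) auto
qed

lemma has_principal_value_minus:
  assumes "has_principal_value g I"
  shows "has_principal_value (\<lambda>y. - g y) (- I)"
  using assms by (auto simp: has_principal_value_def set_integrable_def set_lebesgue_integral_def intro!: tendsto_minus)

text \<open>
  Balls are symmetric, so over \<open>ball 0 \<rho> - ball 0 \<epsilon>\<close> the function \<open>g\<close> and its even part have the same
  integral, and dominated convergence applies as soon as the even part is integrable near the origin.
\<close>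

lemma has_principal_value_exists:
  fixes g H :: "'a::euclidean_space \<Rightarrow> real"
  assumes m: "g \<in> borel_measurable lebesgue"
    and int: "\<And>\<epsilon>. \<epsilon> > 0 \<Longrightarrow> set_integrable lebesgue (- ball 0 \<epsilon>) g" and \<rho>: "\<rho> > 0"
    and H: "set_integrable lebesgue (ball 0 \<rho>) H"
    and gH: "AE y in lebesgue. y \<in> ball 0 \<rho> \<longrightarrow> \<bar>g y + g (- y)\<bar> \<le> H y"
  shows "\<exists>I. has_principal_value g I \<and>
    I \<ge> (LINT y:(- ball 0 \<rho>)|lebesgue. g y) - (LINT y:ball 0 \<rho>|lebesgue. H y) / 2"
proof -
  define S where "S = (\<lambda>y. g y + g (- y))"
  have mS: "S \<in> borel_measurable lebesgue"
    unfolding S_def using m by (intro borel_measurable_add measurable_compose[OF lebesgue_uminus(1)]) auto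
  let ?A = "\<lambda>\<epsilon>. ball (0::'a) \<rho> - ball 0 \<epsilon>"
  let ?O = "LINT y:(- ball 0 \<rho>)|lebesgue. g y"
  have split: "(LINT y:(- ball 0 \<epsilon>)|lebesgue. g y) = ?O + (LINT y:?A \<epsilon>|lebesgue. S y) / 2"
    if \<epsilon>: "0 < \<epsilon>" "\<epsilon> < \<rho>" for \<epsilon>
  proof -
    have iA: "set_integrable lebesgue (?A \<epsilon>) g"
      using int[OF \<epsilon>(1)] by (rule set_integrable_subset) auto
    have un: "- ball (0::'a) \<epsilon> = - ball 0 \<rho> \<union> ?A \<epsilon>" using \<epsilon> by auto
    have "(LINT y:(- ball 0 \<epsilon>)|lebesgue. g y) = ?O + (LINT y:?A \<epsilon>|lebesgue. g y)"
      unfolding un by (intro set_integral_Un int iA \<rho>) auto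
    moreover have "(LINT y:?A \<epsilon>|lebesgue. S y) = (LINT y:?A \<epsilon>|lebesgue. g y) + (LINT y:?A \<epsilon>|lebesgue. g (- y))"
      unfolding S_def by (intro set_integral_add iA set_integral_reflect) auto
    moreover have "(LINT y:?A \<epsilon>|lebesgue. g (- y)) = (LINT y:?A \<epsilon>|lebesgue. g y)"
      by (intro set_integral_reflect iA) auto
    ultimately show ?thesis by simp
  qed
  let ?J = "LINT y:ball 0 \<rho>|lebesgue. S y"
  have Hi: "integrable lebesgue (\<lambda>y. indicator (ball 0 \<rho>) y * H y)"
    using H by (simp add: set_integrable_def)
  have lim: "((\<lambda>\<epsilon>. LINT y:?A \<epsilon>|lebesgue. S y) \<longlongrightarrow> ?J) (at_right 0)"
  proof (rule tendsto_at_right_sequentially[OF \<rho>])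
    fix X :: "nat \<Rightarrow> real" assume X: "\<And>n. 0 < X n" "X \<longlonglongrightarrow> 0"
    show "(\<lambda>n. LINT y:?A (X n)|lebesgue. S y) \<longlonglongrightarrow> ?J"
      unfolding set_lebesgue_integral_def real_scaleR_def
    proof (rule integral_dominated_convergence[OF _ _ Hi])
      show "AE y in lebesgue. (\<lambda>n. indicator (?A (X n)) y * S y) \<longlonglongrightarrow> indicator (ball 0 \<rho>) y * S y"
        using AE_lebesgue_neq[of 0]
      proof eventually_elim
        fix y :: 'a assume "y \<noteq> 0"
        then have "\<forall>\<^sub>F n in sequentially. X n < norm y" using X(2) by (auto intro: order_tendstoD)
        then have "\<forall>\<^sub>F n in sequentially. indicator (ball 0 \<rho>) y * S y = indicator (?A (X n)) y * S y"
          by eventually_elim (auto simp: indicator_def)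
        then show "(\<lambda>n. indicator (?A (X n)) y * S y) \<longlonglongrightarrow> indicator (ball 0 \<rho>) y * S y"
          by (rule Lim_transform_eventually[OF tendsto_const])
      qed
      show "AE y in lebesgue. norm (indicator (?A (X n)) y * S y) \<le> indicator (ball 0 \<rho>) y * H y" for n
        using gH by eventually_elim (auto simp: indicator_def S_def split: if_splits)
    qed (use mS in \<open>auto intro!: borel_measurable_times borel_measurable_indicator\<close>)
  qed
  have "((\<lambda>\<epsilon>. ?O + (LINT y:?A \<epsilon>|lebesgue. S y) / 2) \<longlongrightarrow> ?O + ?J / 2) (at_right 0)"
    by (intro tendsto_intros lim) simp
  moreover have "\<forall>\<^sub>F \<epsilon> in at_right 0. ?O + (LINT y:?A \<epsilon>|lebesgue. S y) / 2 = (LINT y:(- ball 0 \<epsilon>)|lebesgue. g y)"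
    using eventually_at_right_real[OF \<rho>] by eventually_elim (use split in auto)
  ultimately have "((\<lambda>\<epsilon>. LINT y:(- ball 0 \<epsilon>)|lebesgue. g y) \<longlongrightarrow> ?O + ?J / 2) (at_right 0)"
    by (rule Lim_transform_eventually)
  then have 1: "has_principal_value g (?O + ?J / 2)" using int by (simp add: has_principal_value_def)
  have "- (LINT y:ball 0 \<rho>|lebesgue. H y) = (\<integral>y. - (indicator (ball 0 \<rho>) y * H y) \<partial>lebesgue)"
    by (simp add: set_lebesgue_integral_def)
  also have "\<dots> \<le> (\<integral>y. indicator (ball 0 \<rho>) y * S y \<partial>lebesgue)"
  proof (rule integral_mono_AE)
    show "integrable lebesgue (\<lambda>y. indicator (ball 0 \<rho>) y * S y)"
    proof (rule Bochner_Integration.integrable_bound[OF Hi])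
      show "AE y in lebesgue. norm (indicator (ball 0 \<rho>) y * S y) \<le> norm (indicator (ball 0 \<rho>) y * H y)"
        using gH by eventually_elim (auto simp: S_def split: split_indicator)
    qed (intro borel_measurable_times mS borel_measurable_indicator, simp)
    show "AE y in lebesgue. - (indicator (ball 0 \<rho>) y * H y) \<le> indicator (ball 0 \<rho>) y * S y"
      using gH by eventually_elim (auto simp: indicator_def S_def abs_le_iff)
  qed (use Hi in auto)
  finally have "- (LINT y:ball 0 \<rho>|lebesgue. H y) \<le> ?J" by (simp add: set_lebesgue_integral_def)
  then have "?O + ?J / 2 \<ge> ?O - (LINT y:ball 0 \<rho>|lebesgue. H y) / 2" by simp
  with 1 show ?thesis by blast
qed

text \<open>
  The constant depends on the three exponents and the dimension only. This uniformity in the radius is what makes the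
  estimates below invariant under scaling. The bound with the constant \<open>B\<close> merely ensures integrability
  away from the origin.
\<close>

lemma principal_value_lower_bound:
  fixes \<alpha> \<sigma> \<tau> :: real
  assumes "\<alpha> > 0" "\<sigma> > 0" "\<tau> > 0"
  obtains C where "C > 0"
    "\<And>(g::'a::euclidean_space \<Rightarrow> real) \<rho> B D E c A.
      g \<in> borel_measurable lebesgue \<Longrightarrow> \<rho> > 0 \<Longrightarrow> D \<ge> 0 \<Longrightarrow> E \<ge> 0 \<Longrightarrow>
      AE y in lebesgue. \<bar>g y\<bar> \<le> B * norm y powr (- real DIM('a) - \<sigma>) \<Longrightarrow>
      AE y in lebesgue. y \<in> ball 0 \<rho> \<longrightarrow> \<bar>g y + g (- y)\<bar> \<le> D * norm y powr (\<alpha> - real DIM('a)) \<Longrightarrow>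
      AE y in lebesgue. y \<notin> ball 0 \<rho> \<longrightarrow>
         c * indicator A y - E * norm y powr (- real DIM('a) - \<tau>) \<le> g y \<Longrightarrow>
      A \<in> lmeasurable \<Longrightarrow> A \<inter> ball 0 \<rho> = {} \<Longrightarrow>
      \<exists>I. has_principal_value g I \<and>
          I \<ge> c * measure lebesgue A - C * (E * \<rho> powr (- \<tau>) + D * \<rho> powr \<alpha>)"
proof -
  obtain Ci where Ci: "Ci > 0"
    "\<And>\<rho>. \<rho> > 0 \<Longrightarrow> set_integrable lebesgue (ball (0::'a) \<rho>) (\<lambda>y. norm y powr (\<alpha> - real DIM('a)))"
    "\<And>\<rho>. \<rho> > 0 \<Longrightarrow> (LINT y:(ball (0::'a) \<rho>)|lebesgue. norm y powr (\<alpha> - real DIM('a))) \<le> Ci * \<rho> powr \<alpha>"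
    by (rule radial_integral_ball[OF assms(1), where 'a='a]) blast
  obtain Cs where Cs:
    "\<And>\<rho>. \<rho> > 0 \<Longrightarrow> set_integrable lebesgue (- ball (0::'a) \<rho>) (\<lambda>y. norm y powr (- real DIM('a) - \<sigma>))"
    by (rule radial_integral_outside_ball[OF assms(2), where 'a='a]) blast
  obtain Ct where Ct: "Ct > 0"
    "\<And>\<rho>. \<rho> > 0 \<Longrightarrow> set_integrable lebesgue (- ball (0::'a) \<rho>) (\<lambda>y. norm y powr (- real DIM('a) - \<tau>))"
    "\<And>\<rho>. \<rho> > 0 \<Longrightarrow> (LINT y:(- ball (0::'a) \<rho>)|lebesgue. norm y powr (- real DIM('a) - \<tau>)) \<le> Ct * \<rho> powr (- \<tau>)"
    by (rule radial_integral_outside_ball[OF assms(3), where 'a='a]) blast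
  show ?thesis
  proof (rule that[of "Ct + Ci"])
    show "Ct + Ci > 0" using Ct Ci by simp
    fix g :: "'a \<Rightarrow> real" and \<rho> B D E c :: real and A :: "'a set"
    assume m: "g \<in> borel_measurable lebesgue" and \<rho>: "\<rho> > 0" and D: "D \<ge> 0" and E: "E \<ge> 0"
      and b: "AE y in lebesgue. \<bar>g y\<bar> \<le> B * norm y powr (- real DIM('a) - \<sigma>)"
      and inn: "AE y in lebesgue. y \<in> ball 0 \<rho> \<longrightarrow> \<bar>g y + g (- y)\<bar> \<le> D * norm y powr (\<alpha> - real DIM('a))"
      and out: "AE y in lebesgue. y \<notin> ball 0 \<rho> \<longrightarrow>
         c * indicator A y - E * norm y powr (- real DIM('a) - \<tau>) \<le> g y"
      and A: "A \<in> lmeasurable" "A \<inter> ball 0 \<rho> = {}"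
    have int: "set_integrable lebesgue (- ball 0 \<epsilon>) g" if "\<epsilon> > 0" for \<epsilon>
    proof (rule set_integrable_bound)
      show "set_integrable lebesgue (- ball (0::'a) \<epsilon>) (\<lambda>y. B * norm y powr (- real DIM('a) - \<sigma>))"
        by (intro set_integrable_mult_right Cs that)
      show "set_borel_measurable lebesgue (- ball 0 \<epsilon>) g"
        unfolding set_borel_measurable_def using m by (intro borel_measurable_scaleR borel_measurable_indicator) auto
      show "AE y in lebesgue. y \<in> - ball 0 \<epsilon> \<longrightarrow> norm (g y) \<le> norm (B * norm y powr (- real DIM('a) - \<sigma>))"
        using b by eventually_elim (auto intro: order_trans)
    qed
    let ?H = "\<lambda>y::'a. D * norm y powr (\<alpha> - real DIM('a))"
    have Hint: "set_integrable lebesgue (ball 0 \<rho>) ?H" by (intro set_integrable_mult_right Ci \<rho>)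
    have "\<exists>I. has_principal_value g I \<and>
      I \<ge> (LINT y:(- ball 0 \<rho>)|lebesgue. g y) - (LINT y:ball 0 \<rho>|lebesgue. ?H y) / 2"
      by (rule has_principal_value_exists[where H = ?H, OF m _ \<rho> Hint inn], rule int)
    then obtain I where I: "has_principal_value g I"
      "I \<ge> (LINT y:(- ball 0 \<rho>)|lebesgue. g y) - (LINT y:ball 0 \<rho>|lebesgue. ?H y) / 2"
      by blast
    have "(LINT y:ball 0 \<rho>|lebesgue. ?H y) \<le> D * (Ci * \<rho> powr \<alpha>)"
      by (subst set_integral_mult_right) (intro mult_left_mono Ci \<rho> D)
    moreover have "(LINT y:ball 0 \<rho>|lebesgue. ?H y) \<ge> 0"
      unfolding set_lebesgue_integral_def using D by (intro Bochner_Integration.integral_nonneg) simp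
    ultimately have i1: "(LINT y:ball 0 \<rho>|lebesgue. ?H y) / 2 \<le> D * (Ci * \<rho> powr \<alpha>)"
      by linarith
    have iA: "set_integrable lebesgue (- ball 0 \<rho>) (indicator A :: 'a \<Rightarrow> real)"
    proof (rule set_integrable_subset)
      show "set_integrable lebesgue UNIV (indicator A :: 'a \<Rightarrow> real)"
        using A(1) by (simp add: set_integrable_def lmeasurable_iff_integrable)
    qed simp_all
    let ?c = "\<lambda>y::'a. c * indicator A y" and ?E = "\<lambda>y::'a. E * norm y powr (- real DIM('a) - \<tau>)"
    have ic: "set_integrable lebesgue (- ball 0 \<rho>) ?c"
      using set_integrable_mult_right[of c lebesgue "- ball 0 \<rho>" "indicator A :: 'a \<Rightarrow> real"] iA by blast
    have iE: "set_integrable lebesgue (- ball 0 \<rho>) ?E"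
      by (rule set_integrable_mult_right, rule Ct(2)[OF \<rho>])
    have "(LINT y:(- ball 0 \<rho>)|lebesgue. c * indicator A y - E * norm y powr (- real DIM('a) - \<tau>)) =
        c * (LINT y:(- ball 0 \<rho>)|lebesgue. indicator A y) - E * (LINT y:(- ball (0::'a) \<rho>)|lebesgue. norm y powr (- real DIM('a) - \<tau>))"
      unfolding set_integral_diff(2)[OF ic iE] by simp
    also have "(LINT y:(- ball 0 \<rho>)|lebesgue. indicator A y) = measure lebesgue A"
    proof -
      have "(LINT y:(- ball 0 \<rho>)|lebesgue. indicator A y) = integral\<^sup>L lebesgue (indicator A :: 'a \<Rightarrow> real)"
        unfolding set_lebesgue_integral_def using A(2) by (intro Bochner_Integration.integral_cong) (auto simp: indicator_def)
      then show ?thesis by simp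
    qed
    finally have "c * measure lebesgue A - E * (LINT y:(- ball (0::'a) \<rho>)|lebesgue. norm y powr (- real DIM('a) - \<tau>))
       \<le> (LINT y:(- ball 0 \<rho>)|lebesgue. g y)"
      using set_integral_mono_AE[OF set_integral_diff(1)[OF ic iE] int[OF \<rho>]] out by simp
    moreover have "E * (LINT y:(- ball (0::'a) \<rho>)|lebesgue. norm y powr (- real DIM('a) - \<tau>)) \<le> E * (Ct * \<rho> powr (- \<tau>))"
      by (intro mult_left_mono Ct \<rho> E)
    moreover have "0 \<le> Ci * (E * \<rho> powr (- \<tau>))" "0 \<le> Ct * (D * \<rho> powr \<alpha>)" using Ci Ct D E by auto
    moreover have "(Ct + Ci) * (E * \<rho> powr (- \<tau>) + D * \<rho> powr \<alpha>) =
        E * (Ct * \<rho> powr (- \<tau>)) + D * (Ci * \<rho> powr \<alpha>) + Ci * (E * \<rho> powr (- \<tau>)) + Ct * (D * \<rho> powr \<alpha>)"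
      by (simp add: algebra_simps)
    ultimately have "I \<ge> c * measure lebesgue A - (Ct + Ci) * (E * \<rho> powr (- \<tau>) + D * \<rho> powr \<alpha>)"
      using I(2) i1 by linarith
    then show "\<exists>I. has_principal_value g I \<and> I \<ge> c * measure lebesgue A - (Ct + Ci) * (E * \<rho> powr (- \<tau>) + D * \<rho> powr \<alpha>)"
      using I(1) by blast
  qed
qed

section \<open>The signed power\<close>

lemma signed_power_minus: "signed_power e (- d) = - signed_power e d"
  by (simp add: signed_power_def)

lemma signed_power_nonneg_eq:
  assumes "d \<ge> 0" "e > 1"
  shows "signed_power e d = d powr (e - 1)"
proof (cases "d = 0")
  case False
  have "d powr (e - 2) * d powr 1 = d powr (e - 1)" unfolding powr_add[symmetric] by simp
  then show ?thesis using assms False by (simp add: signed_power_def)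
qed (use assms in \<open>simp add: signed_power_def\<close>)

lemma abs_signed_power:
  assumes "e > 1"
  shows "\<bar>signed_power e d\<bar> = \<bar>d\<bar> powr (e - 1)"
  using signed_power_nonneg_eq[OF abs_ge_zero assms, of d]
  by (simp add: signed_power_def abs_mult)

lemma signed_power_mono:
  assumes "e > 1" "c \<le> d"
  shows "signed_power e c \<le> signed_power e d"
proof -
  consider "0 \<le> c" | "c < 0" "0 \<le> d" | "d < 0" by linarith
  then show ?thesis
  proof cases
    case 1
    then show ?thesis using assms by (simp add: signed_power_nonneg_eq powr_mono2)
  next
    case 2
    have "signed_power e c \<le> 0" using 2 by (auto simp: signed_power_def intro: mult_nonneg_nonpos)
    moreover have "0 \<le> signed_power e d" using 2 by (auto simp: signed_power_def)
    ultimately show ?thesis by linarith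
  next
    case 3
    have "signed_power e (- d) \<le> signed_power e (- c)"
      using 3 assms by (simp add: signed_power_nonneg_eq powr_mono2 del: minus_diff_eq)
    then show ?thesis by (simp add: signed_power_minus)
  qed
qed

lemma borel_measurable_signed_power [measurable]: "signed_power e \<in> borel_measurable borel"
  unfolding signed_power_def[abs_def] by measurable

text \<open>
  For \<open>e \<ge> 2\<close> the signed power is Lipschitz on bounded sets: its derivative is \<open>(e - 1) * \<bar>d\<bar> powr (e - 2)\<close>.
  The mean value theorem is applied on the positive half-line only, because at 0 the formula for the
  derivative fails for \<open>e = 2\<close> (\<open>0 powr 0 = 0\<close>). Arguments of opposite sign are compared through 0.
\<close>

lemma signed_power_diff_le:
  assumes e: "e \<ge> 2" and m: "\<bar>c\<bar> \<le> m" "\<bar>d\<bar> \<le> m"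
  shows "\<bar>signed_power e c - signed_power e d\<bar> \<le> (e - 1) * m powr (e - 2) * \<bar>c - d\<bar>"
proof -
  have sp: "signed_power e x = x powr (e - 1)" if "x \<ge> 0" for x
    using that e by (simp add: signed_power_nonneg_eq)
  have pos: "signed_power e x - signed_power e y \<le> (e - 1) * m powr (e - 2) * (x - y)"
    if "0 \<le> y" "y \<le> x" "x \<le> m" for x y
  proof -
    consider "x = y" | "y = 0" "x > 0" | "y > 0" "y < x" using \<open>0 \<le> y\<close> \<open>y \<le> x\<close> by linarith
    then show ?thesis
    proof cases
      case 2
      have "x powr (e - 2) * x powr 1 = x powr (e - 1)" unfolding powr_add[symmetric] by simp
      then have "x powr (e - 1) = x powr (e - 2) * x" using 2 by simp
      also have "\<dots> \<le> (e - 1) * m powr (e - 2) * x"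
      proof (intro mult_right_mono)
        have "1 * x powr (e - 2) \<le> (e - 1) * m powr (e - 2)"
          using e that by (intro mult_mono powr_mono2) auto
        then show "x powr (e - 2) \<le> (e - 1) * m powr (e - 2)" by simp
      qed (use 2 in auto)
      finally show ?thesis using 2 e by (simp add: sp)
    next
      case 3
      have "\<exists>z>y. z < x \<and> x powr (e - 1) - y powr (e - 1) = (x - y) * ((e - 1) * z powr (e - 1 - 1))"
        using 3 by (intro MVT2 has_real_derivative_powr) auto
      then obtain z where z: "y < z" "z < x" "x powr (e - 1) - y powr (e - 1) = (x - y) * ((e - 1) * z powr (e - 2))"
        by auto
      have "(x - y) * ((e - 1) * z powr (e - 2)) \<le> (x - y) * ((e - 1) * m powr (e - 2))"
        using z 3 that e by (intro mult_left_mono powr_mono2) auto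
      then show ?thesis using z 3 by (simp add: sp mult_ac)
    qed (use e in auto)
  qed
  have opp: "signed_power e x + signed_power e y \<le> (e - 1) * m powr (e - 2) * (x + y)"
    if "0 \<le> y" "0 \<le> x" "x \<le> m" "y \<le> m" for x y
    using pos[of 0 x] pos[of 0 y] that e by (simp add: sp distrib_left)
  consider "0 \<le> c" "0 \<le> d" | "0 \<le> c" "d < 0" | "c < 0" "0 \<le> d" | "c < 0" "d < 0" by linarith
  then show ?thesis
  proof cases
    case 1
    show ?thesis
    proof (cases "c \<le> d")
      case True
      then show ?thesis using pos[of c d] signed_power_mono[of e c d] 1 m e by auto
    next
      case False
      then show ?thesis using pos[of d c] signed_power_mono[of e d c] 1 m e by auto
    qed
  next
    case 2
    then show ?thesis using opp[of c "-d"] signed_power_mono[of e d c] m e by (auto simp: signed_power_minus)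
  next
    case 3
    then show ?thesis using opp[of "-c" d] signed_power_mono[of e c d] m e by (auto simp: signed_power_minus)
  next
    case 4
    show ?thesis
    proof (cases "c \<le> d")
      case True
      then show ?thesis using pos[of "-d" "-c"] signed_power_mono[of e c d] 4 m e by (auto simp: signed_power_minus)
    next
      case False
      then show ?thesis using pos[of "-c" "-d"] signed_power_mono[of e d c] 4 m e by (auto simp: signed_power_minus)
    qed
  qed
qed

section \<open>The operator at a point of contact\<close>

definition paraboloid :: "real \<Rightarrow> real \<Rightarrow> 'a::euclidean_space \<Rightarrow> 'a \<Rightarrow> real" where
  "paraboloid b c x0 x = b + c * (norm (x - x0))\<^sup>2"

text \<open>
  The test function at a point of contact: over \<open>ball x0 r\<close> the paraboloid has height \<open>\<kappa> * \<omega>\<close>. The radius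
  \<open>r/4\<close> fits because points of contact lie in \<open>cball x0 (3*r/4)\<close>.
\<close>

definition contact_test ::
  "('a::euclidean_space \<Rightarrow> real) \<Rightarrow> 'a \<Rightarrow> 'a \<Rightarrow> real \<Rightarrow> real \<Rightarrow> real \<Rightarrow> real \<Rightarrow> 'a \<Rightarrow> real" where
  "contact_test u x0 x1 r \<omega> \<kappa> b = glue x1 (r/4) (paraboloid b (\<kappa> * \<omega> / r\<^sup>2) x0) u"

text \<open>
  The situation at the point of contact \<open>x1\<close> in which the operator is large: up to an error of order
  \<open>\<delta> * \<omega>\<close> that grows slowly with the distance, \<open>u x1\<close> is a global maximum, and on \<open>G\<close> the values of \<open>u\<close>
  are lower by at least \<open>\<omega> / 2\<close>. The factor 10 comes from \<open>2 * norm (z - x0) / r \<le> 10 * norm (z - x1) / r\<close>,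
  valid for \<open>norm (z - x1) \<ge> r/4\<close>.
\<close>

definition good_contact ::
  "real \<Rightarrow> ('a::euclidean_space \<Rightarrow> real) \<Rightarrow> 'a \<Rightarrow> 'a \<Rightarrow> real \<Rightarrow> real \<Rightarrow> real \<Rightarrow> real \<Rightarrow> real \<Rightarrow> 'a set \<Rightarrow> bool"
  where
  "good_contact \<eta> u x0 x1 r \<omega> \<kappa> \<delta> b G \<longleftrightarrow>
     u \<in> borel_measurable lebesgue \<and> bounded (range u) \<and>
     r > 0 \<and> \<omega> > 0 \<and> \<kappa> > 0 \<and> \<kappa> \<le> \<delta> \<and> x1 \<in> ball x0 r \<and>
     u x1 = paraboloid b (\<kappa> * \<omega> / r\<^sup>2) x0 x1 \<and>
     (AE z in lebesgue. z \<notin> ball x1 (r/4) \<longrightarrow>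
        u z - u x1 \<le> 2 * \<omega> * \<delta> * (10 * norm (z - x1) / r) powr \<eta>) \<and>
     G \<in> lmeasurable \<and> G \<subseteq> ball x0 r - ball x1 (r/4) \<and> (\<forall>z\<in>G. u x1 - u z \<ge> \<omega> / 2)"

abbreviation has_phase_value ::
  "real \<Rightarrow> ('a::euclidean_space \<Rightarrow> real) \<Rightarrow> ('a \<Rightarrow> real) \<Rightarrow> 'a \<Rightarrow> real \<Rightarrow> bool" where
  "has_phase_value e k w x I \<equiv> has_principal_value (\<lambda>y. signed_power e (w x - w (x + y)) * k y) I"

text \<open>
  One phase with exponent \<open>e\<close> and a kernel \<open>k\<close> of order \<open>\<sigma>\<close>. Everything scales like
  \<open>\<omega> powr (e - 1) * r powr (- \<sigma>)\<close>: the set \<open>G\<close> contributes the positive term, while the paraboloid and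
  the tail are small with \<open>\<delta>\<close>. The tail converges because \<open>\<eta> * (e - 1) < \<sigma>\<close>. Near \<open>x1\<close> the increments
  \<open>d y\<close> of the paraboloid are at most \<open>3 * \<kappa> * \<omega> * norm y / r\<close>. If \<open>e - 1 > \<sigma>\<close>, this makes the integrand
  absolutely integrable. Otherwise \<open>k\<close> is even and \<open>g y + g (- y)\<close> involves the second difference of the
  paraboloid, which gains another factor \<open>norm y / r\<close>.

  The lower bound of \<open>k\<close> is a separate parameter \<open>\<mu>\<close>, since the coefficient of the second phase may
  vanish, and that phase is used with \<open>\<mu> = 0\<close>.
\<close>

lemma one_phase_lower_bound:
  fixes e \<sigma> \<eta> \<Lambda> :: real
  assumes e: "e > 1" and \<sigma>: "\<sigma> > 0" and \<Lambda>: "\<Lambda> > 0" and \<eta>: "\<eta> \<ge> 0" "\<eta> * (e - 1) < \<sigma>"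
    and cases: "e - 1 > \<sigma> \<or> e \<ge> 2 \<and> \<sigma> < e"
  obtains C where "C > 0"
    "\<And>(k :: 'a::euclidean_space \<Rightarrow> real) u x0 x1 r \<omega> \<kappa> \<delta> b G \<mu>.
      k \<in> borel_measurable lebesgue \<Longrightarrow>
      AE y in lebesgue. 0 \<le> k y \<and> k y \<le> \<Lambda> * norm y powr (- real DIM('a) - \<sigma>) \<Longrightarrow>
      e - 1 > \<sigma> \<or> (\<forall>y. k (- y) = k y) \<Longrightarrow>
      \<mu> \<ge> 0 \<Longrightarrow> AE y in lebesgue. \<mu> * norm y powr (- real DIM('a) - \<sigma>) \<le> k y \<Longrightarrow>
      good_contact \<eta> u x0 x1 r \<omega> \<kappa> \<delta> b G \<Longrightarrow>
      \<exists>I. has_phase_value e k (contact_test u x0 x1 r \<omega> \<kappa> b) x1 I \<and>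
          I \<ge> \<mu> * (\<omega>/2) powr (e - 1) * (2 * r) powr (- real DIM('a) - \<sigma>) * measure lebesgue G
              - C * (\<omega> * \<delta>) powr (e - 1) * r powr (- \<sigma>)"
proof -
  define \<alpha> where "\<alpha> = (if e - 1 > \<sigma> then e - 1 - \<sigma> else e - \<sigma>)"
  define \<tau> where "\<tau> = \<sigma> - \<eta> * (e - 1)"
  have \<alpha>: "\<alpha> > 0" using cases by (auto simp: \<alpha>_def)
  have \<tau>: "\<tau> > 0" using \<eta> by (simp add: \<tau>_def)
  obtain C where C: "C > 0"
    "\<And>(g::'a \<Rightarrow> real) \<rho> B D E c A.
      g \<in> borel_measurable lebesgue \<Longrightarrow> \<rho> > 0 \<Longrightarrow> D \<ge> 0 \<Longrightarrow> E \<ge> 0 \<Longrightarrow>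
      AE y in lebesgue. \<bar>g y\<bar> \<le> B * norm y powr (- real DIM('a) - \<sigma>) \<Longrightarrow>
      AE y in lebesgue. y \<in> ball 0 \<rho> \<longrightarrow> \<bar>g y + g (- y)\<bar> \<le> D * norm y powr (\<alpha> - real DIM('a)) \<Longrightarrow>
      AE y in lebesgue. y \<notin> ball 0 \<rho> \<longrightarrow>
         c * indicator A y - E * norm y powr (- real DIM('a) - \<tau>) \<le> g y \<Longrightarrow>
      A \<in> lmeasurable \<Longrightarrow> A \<inter> ball 0 \<rho> = {} \<Longrightarrow>
      \<exists>I. has_principal_value g I \<and>
          I \<ge> c * measure lebesgue A - C * (E * \<rho> powr (- \<tau>) + D * \<rho> powr \<alpha>)"
    by (rule principal_value_lower_bound[OF \<alpha> \<sigma> \<tau>, where 'a='a]) blast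
  (* E0 and D0 bound the tail and the paraboloid at unit scale; the exponent \<alpha> above is the order of
     integrability at the origin, so that \<alpha> + \<sigma> is e - 1 or e. *)
  define D0 where "D0 = 2 * e * \<Lambda> * 3 powr (e - 1)"
  define E0 where "E0 = \<Lambda> * 2 powr (e - 1) * 10 powr (\<eta> * (e - 1)) * 4 powr \<tau>"
  have D0: "D0 > 0" and E0: "E0 > 0" using e \<Lambda> by (auto simp: D0_def E0_def)
  show ?thesis
  proof (rule that[of "C * (E0 + D0)"])
    show "C * (E0 + D0) > 0" using C D0 E0 by simp
    fix k u :: "'a \<Rightarrow> real" and x0 x1 :: 'a and r \<omega> \<kappa> \<delta> b \<mu> :: real and G :: "'a set"
    assume km: "k \<in> borel_measurable lebesgue"
      and kub: "AE y in lebesgue. 0 \<le> k y \<and> k y \<le> \<Lambda> * norm y powr (- real DIM('a) - \<sigma>)"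
      and ksym: "e - 1 > \<sigma> \<or> (\<forall>y. k (- y) = k y)"
      and \<mu>: "\<mu> \<ge> 0" and klb: "AE y in lebesgue. \<mu> * norm y powr (- real DIM('a) - \<sigma>) \<le> k y"
      and contact: "good_contact \<eta> u x0 x1 r \<omega> \<kappa> \<delta> b G"
    have um: "u \<in> borel_measurable lebesgue" and ub: "bounded (range u)"
      and r: "r > 0" and \<omega>: "\<omega> > 0" and \<kappa>: "\<kappa> > 0" "\<kappa> \<le> \<delta>" and x1: "x1 \<in> ball x0 r"
      and touch: "u x1 = b + \<kappa> * \<omega> / r\<^sup>2 * (norm (x1 - x0))\<^sup>2"
      and tail: "AE z in lebesgue. z \<notin> ball x1 (r/4) \<longrightarrow> u z - u x1 \<le> 2 * \<omega> * \<delta> * (10 * norm (z - x1) / r) powr \<eta>"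
      and Gm: "G \<in> lmeasurable" and GS: "G \<subseteq> ball x0 r - ball x1 (r/4)" and Gu: "\<forall>z\<in>G. u x1 - u z \<ge> \<omega> / 2"
      using contact[unfolded good_contact_def paraboloid_def] by blast+
    define \<phi> where "\<phi> = (\<lambda>x. b + \<kappa> * \<omega> / r\<^sup>2 * (norm (x - x0))\<^sup>2)"
    define w where "w = contact_test u x0 x1 r \<omega> \<kappa> b"
    have w_def': "w = glue x1 (r/4) \<phi> u"
      by (simp add: w_def contact_test_def \<phi>_def paraboloid_def[abs_def])
    define d where "d = (\<lambda>y. w x1 - w (x1 + y))"
    define g where "g = (\<lambda>y. signed_power e (d y) * k y)"
    define K where "K = \<kappa> * \<omega> / r\<^sup>2"
    define A where "A = (+) (- x1) ` G"
    define c where "c = \<mu> * (\<omega>/2) powr (e - 1) * (2 * r) powr (- real DIM('a) - \<sigma>)"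
    define D where "D = D0 * (\<kappa> * \<omega>) powr (e - 1) * r powr (- \<alpha> - \<sigma>)"
    define E where "E = \<Lambda> * (2 * \<omega> * \<delta>) powr (e - 1) * (10 / r) powr (\<eta> * (e - 1))"
    have K: "K > 0" using \<kappa> \<omega> r by (simp add: K_def)
    have \<delta>: "\<delta> > 0" using \<kappa> by linarith
    have wm: "w \<in> borel_measurable lebesgue"
      unfolding w_def' glue_def \<phi>_def
      by (intro measurable_If_set um borel_measurable_add borel_measurable_times measurable_completion) auto
    have dm: "d \<in> borel_measurable lebesgue"
      unfolding d_def by (intro borel_measurable_diff measurable_compose[OF lebesgue_plus(1) wm]) auto
    have gm: "g \<in> borel_measurable lebesgue"
      unfolding g_def by (intro borel_measurable_times km measurable_compose[OF dm borel_measurable_signed_power])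
    obtain B where B: "\<And>z. \<bar>u z\<bar> \<le> B" using ub by (auto simp: bounded_iff)
    have w1: "w x1 = u x1" using r touch by (simp add: w_def' glue_def \<phi>_def)
    have d_in: "d y = - K * (2 * ((x1 - x0) \<bullet> y) + (norm y)\<^sup>2)" if "y \<in> ball 0 (r/4)" for y
    proof -
      have "w (x1 + y) = \<phi> (x1 + y)" using that by (simp add: w_def' glue_def dist_norm)
      moreover have "(norm (x1 + y - x0))\<^sup>2 = (norm (x1 - x0))\<^sup>2 + 2 * ((x1 - x0) \<bullet> y) + (norm y)\<^sup>2"
        unfolding power2_norm_eq_inner by (simp add: inner_diff inner_add inner_commute algebra_simps)
      ultimately have "d y = K * (norm (x1 - x0))\<^sup>2 - K * ((norm (x1 - x0))\<^sup>2 + 2 * ((x1 - x0) \<bullet> y) + (norm y)\<^sup>2)"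
        unfolding d_def w1 touch by (simp add: \<phi>_def K_def)
      then show ?thesis by (simp only: distrib_left)
    qed
    have d_le: "\<bar>d y\<bar> \<le> 3 * \<kappa> * \<omega> * norm y / r" if y: "y \<in> ball 0 (r/4)" for y
    proof -
      have "\<bar>(x1 - x0) \<bullet> y\<bar> \<le> norm (x1 - x0) * norm y" by (rule Cauchy_Schwarz_ineq2)
      also have "\<dots> \<le> r * norm y" using x1 by (intro mult_right_mono) (auto simp: dist_norm norm_minus_commute)
      finally have 1: "\<bar>(x1 - x0) \<bullet> y\<bar> \<le> r * norm y" .
      have "(norm y)\<^sup>2 \<le> r * norm y"
        unfolding power2_eq_square using y r by (intro mult_right_mono) auto
      then have "\<bar>2 * ((x1 - x0) \<bullet> y) + (norm y)\<^sup>2\<bar> \<le> 3 * (r * norm y)"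
        using 1 by (intro order_trans[OF abs_triangle_ineq]) auto
      then have "K * \<bar>2 * ((x1 - x0) \<bullet> y) + (norm y)\<^sup>2\<bar> \<le> K * (3 * (r * norm y))"
        using K by (intro mult_left_mono) auto
      also have "\<dots> = 3 * \<kappa> * \<omega> * norm y / r" using r by (simp add: K_def power2_eq_square)
      finally show ?thesis using d_in[OF y] K by (simp add: abs_mult)
    qed
    have d_out: "d y = u x1 - u (x1 + y)" if "y \<notin> ball 0 (r/4)" for y
      using that w1 by (simp add: d_def w_def' glue_def dist_norm)
    have d_bd: "\<bar>d y\<bar> \<le> max (\<kappa> * \<omega>) (2 * B)" for y
    proof (cases "y \<in> ball 0 (r/4)")
      case True
      have "3 * (\<kappa> * \<omega>) * (norm y / r) \<le> 3 * (\<kappa> * \<omega>) * (1/4)"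
        using True r \<kappa> \<omega> by (intro mult_left_mono) (auto simp: field_simps)
      also have "\<dots> \<le> \<kappa> * \<omega>" using \<kappa> \<omega> by simp
      finally show ?thesis using d_le[OF True] by simp
    next
      case False
      then show ?thesis using d_out[OF False] B[of x1] B[of "x1 + y"] by linarith
    qed
    have bound: "AE y in lebesgue. \<bar>g y\<bar> \<le> (max (\<kappa> * \<omega>) (2 * B) powr (e - 1) * \<Lambda>) * norm y powr (- real DIM('a) - \<sigma>)"
      using kub
    proof eventually_elim
      fix y assume y: "0 \<le> k y \<and> k y \<le> \<Lambda> * norm y powr (- real DIM('a) - \<sigma>)"
      have "\<bar>g y\<bar> = \<bar>d y\<bar> powr (e - 1) * k y" using y e by (simp add: g_def abs_mult abs_signed_power)
      also have "\<dots> \<le> max (\<kappa> * \<omega>) (2 * B) powr (e - 1) * (\<Lambda> * norm y powr (- real DIM('a) - \<sigma>))"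
        using y e d_bd by (intro mult_mono powr_mono2) auto
      finally show "\<bar>g y\<bar> \<le> (max (\<kappa> * \<omega>) (2 * B) powr (e - 1) * \<Lambda>) * norm y powr (- real DIM('a) - \<sigma>)" by simp
    qed
    have powy: "(3 * \<kappa> * \<omega> * norm y / r) powr (e - 1) = 3 powr (e - 1) * (\<kappa> * \<omega>) powr (e - 1) * norm y powr (e - 1) * r powr (- (e - 1))"
      if "y \<noteq> 0" for y :: 'a
      using \<kappa> \<omega> r that unfolding powr_minus[of r "e - 1"] by (simp add: powr_mult powr_divide inverse_eq_divide)
    have inner: "AE y in lebesgue. y \<in> ball 0 (r/4) \<longrightarrow> \<bar>g y + g (- y)\<bar> \<le> D * norm y powr (\<alpha> - real DIM('a))"
      using kub AE_lebesgue_uminus[OF kub] AE_lebesgue_neq[of 0]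
    proof eventually_elim
      fix y :: 'a
      assume y: "0 \<le> k y \<and> k y \<le> \<Lambda> * norm y powr (- real DIM('a) - \<sigma>)"
        "0 \<le> k (- y) \<and> k (- y) \<le> \<Lambda> * norm (- y) powr (- real DIM('a) - \<sigma>)" "y \<noteq> 0"
      show "y \<in> ball 0 (r/4) \<longrightarrow> \<bar>g y + g (- y)\<bar> \<le> D * norm y powr (\<alpha> - real DIM('a))"
      proof
        assume yb: "y \<in> ball 0 (r/4)"
        then have yb': "- y \<in> ball 0 (r/4)" by simp
        let ?P = "3 powr (e - 1) * (\<kappa> * \<omega>) powr (e - 1) * norm y powr (e - 1) * r powr (- (e - 1)) * (\<Lambda> * norm y powr (- real DIM('a) - \<sigma>))"
        have P0: "?P \<ge> 0" using \<Lambda> by simp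
        show "\<bar>g y + g (- y)\<bar> \<le> D * norm y powr (\<alpha> - real DIM('a))"
        proof (cases "e - 1 > \<sigma>")
          case True
          have one: "\<bar>g z\<bar> \<le> ?P" if z: "z = y \<or> z = - y" for z
          proof -
            have "\<bar>g z\<bar> = \<bar>d z\<bar> powr (e - 1) * k z" using y z e by (auto simp add: g_def abs_mult abs_signed_power)
            also have "\<dots> \<le> (3 * \<kappa> * \<omega> * norm y / r) powr (e - 1) * (\<Lambda> * norm y powr (- real DIM('a) - \<sigma>))"
              using y z e d_le[OF yb] d_le[OF yb'] by (intro mult_mono powr_mono2) auto
            finally show ?thesis unfolding powy[OF y(3)] by simp
          qed
          have "\<bar>g y + g (- y)\<bar> \<le> 2 * ?P" using one[OF disjI1[OF refl]] one[OF disjI2[OF refl]] abs_triangle_ineq[of "g y" "g (- y)"] by linarith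
          also have "\<dots> \<le> (2 * e) * ?P" using e P0 by (intro mult_right_mono) auto
          also have "\<dots> = D0 * (\<kappa> * \<omega>) powr (e - 1) * r powr (- (e - 1)) * (norm y powr (e - 1) * norm y powr (- real DIM('a) - \<sigma>))"
            by (simp add: D0_def)
          also have "norm y powr (e - 1) * norm y powr (- real DIM('a) - \<sigma>) = norm y powr (\<alpha> - real DIM('a))"
            using True y(3) by (simp flip: powr_add add: \<alpha>_def algebra_simps)
          also have "r powr (- (e - 1)) = r powr (- \<alpha> - \<sigma>)" using True by (simp add: \<alpha>_def)
          finally show ?thesis by (simp add: D_def)
        next
          case False
          then have e2: "e \<ge> 2" and sym: "k (- y) = k y" using cases ksym by auto
          let ?m = "3 * \<kappa> * \<omega> * norm y / r"
          have m0: "?m > 0" using \<kappa> \<omega> r y(3) by simp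
          have "g y + g (- y) = (signed_power e (d y) - signed_power e (- d (- y))) * k y"
            by (simp add: g_def sym signed_power_minus algebra_simps)
          then have "\<bar>g y + g (- y)\<bar> = \<bar>signed_power e (d y) - signed_power e (- d (- y))\<bar> * k y"
            using y by (simp add: abs_mult)
          also have "\<dots> \<le> ((e - 1) * ?m powr (e - 2) * \<bar>d y - (- d (- y))\<bar>) * (\<Lambda> * norm y powr (- real DIM('a) - \<sigma>))"
            using y d_le[OF yb] d_le[OF yb'] e2 by (intro mult_mono signed_power_diff_le) auto
          also have "d y - (- d (- y)) = - 2 * K * (norm y)\<^sup>2"
            using d_in[OF yb] d_in[OF yb'] by (simp add: algebra_simps)
          also have "\<bar>- 2 * K * (norm y)\<^sup>2\<bar> = ?m * (2/3 * norm y / r)"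
            using K r by (simp add: abs_mult) (simp add: K_def power2_eq_square)
          also have "(e - 1) * ?m powr (e - 2) * (?m * (2/3 * norm y / r)) = (e - 1) * (2/3) * (?m powr (e - 2) * ?m powr 1) * (norm y / r)"
          proof -
            have "e' * b * (x * (2/3 * n / r)) = e' * (2/3) * (b * x) * (n / r)" for e' b x n :: real by simp
            moreover have "?m powr 1 = ?m" using m0 by (rule powr_one[OF less_imp_le])
            ultimately show ?thesis by (simp only:)
          qed
          also have "?m powr (e - 2) * ?m powr 1 = ?m powr (e - 1)" unfolding powr_add[symmetric] by simp
          also have "?m powr (e - 1) = 3 powr (e - 1) * (\<kappa> * \<omega>) powr (e - 1) * norm y powr (e - 1) * r powr (- (e - 1))"
            by (rule powy[OF y(3)])
          finally have "\<bar>g y + g (- y)\<bar> \<le> (e - 1) * (2/3) * (?P * (norm y / r))" by (simp add: mult_ac)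
          also have "\<dots> \<le> (2 * e) * (?P * (norm y / r))"
            using e P0 r by (intro mult_right_mono) auto
          also have "\<dots> = D0 * (\<kappa> * \<omega>) powr (e - 1) * (r powr (- (e - 1)) * r powr (- 1)) * (norm y powr (e - 1) * norm y powr (- real DIM('a) - \<sigma>) * norm y powr 1)"
            using r by (simp add: D0_def powr_minus divide_inverse)
          also have "norm y powr (e - 1) * norm y powr (- real DIM('a) - \<sigma>) * norm y powr 1 = norm y powr (\<alpha> - real DIM('a))"
            using False unfolding powr_add[symmetric] by (simp add: \<alpha>_def algebra_simps)
          also have "r powr (- (e - 1)) * r powr (- 1) = r powr (- \<alpha> - \<sigma>)" using False unfolding powr_add[symmetric] by (simp add: \<alpha>_def)
          finally show ?thesis by (simp add: D_def)
        qed
      qed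
    qed
    have outer: "AE y in lebesgue. y \<notin> ball 0 (r/4) \<longrightarrow> c * indicator A y - E * norm y powr (- real DIM('a) - \<tau>) \<le> g y"
      using kub klb AE_lebesgue_plus[OF tail, of x1]
    proof (eventually_elim, intro impI)
      fix y :: 'a
      assume ku: "0 \<le> k y \<and> k y \<le> \<Lambda> * norm y powr (- real DIM('a) - \<sigma>)"
        and kl: "\<mu> * norm y powr (- real DIM('a) - \<sigma>) \<le> k y"
        and ta: "x1 + y \<notin> ball x1 (r/4) \<longrightarrow> u (x1 + y) - u x1 \<le> 2 * \<omega> * \<delta> * (10 * norm (x1 + y - x1) / r) powr \<eta>"
        and yo: "y \<notin> ball 0 (r/4)"
      have y0: "norm y > 0" using yo r by auto
      have Ey: "E * norm y powr (- real DIM('a) - \<tau>) \<ge> 0" using \<Lambda> by (simp add: E_def)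
      show "c * indicator A y - E * norm y powr (- real DIM('a) - \<tau>) \<le> g y"
      proof (cases "y \<in> A")
        case True
        then have z: "x1 + y \<in> G" by (auto simp: A_def)
        then have "dist x0 (x1 + y) < r" using GS by auto
        then have "norm y < 2 * r" using x1 norm_triangle_ineq4[of "x1 + y - x0" "x1 - x0"] by (auto simp: dist_norm norm_minus_commute)
        have "c \<le> (\<omega>/2) powr (e - 1) * (\<mu> * norm y powr (- real DIM('a) - \<sigma>))"
          unfolding c_def using \<mu> \<open>norm y < 2 * r\<close> y0 \<sigma> 
          by (simp add: mult.assoc mult.left_commute[of \<mu>] mult_left_mono powr_mono2')
        also have "\<dots> \<le> signed_power e (d y) * k y"
        proof (intro mult_mono kl)
          have "signed_power e (\<omega>/2) \<le> signed_power e (d y)"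
            using Gu z d_out[OF yo] e by (intro signed_power_mono) auto
          then show "(\<omega>/2) powr (e - 1) \<le> signed_power e (d y)" using \<omega> e by (simp add: signed_power_nonneg_eq)
          then show "0 \<le> signed_power e (d y)" using powr_ge_zero order_trans by blast
        qed (use \<mu> in auto)
        finally show ?thesis using True Ey by (simp add: g_def)
      next
        case False
        let ?N = "2 * \<omega> * \<delta> * (10 * norm y / r) powr \<eta>"
        have N0: "?N \<ge> 0" using \<omega> \<delta> by simp
        have "- ?N \<le> d y" using ta yo d_out[OF yo] by (simp add: dist_norm)
        then have "signed_power e (- ?N) \<le> signed_power e (d y)" using e by (intro signed_power_mono) auto
        then have 1: "- (?N powr (e - 1)) \<le> signed_power e (d y)"
          using N0 e by (simp add: signed_power_minus signed_power_nonneg_eq)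
        have N_eq: "?N powr (e - 1) = (2 * \<omega> * \<delta>) powr (e - 1) * ((10 / r) powr (\<eta> * (e - 1)) * norm y powr (\<eta> * (e - 1)))"
          using \<omega> \<delta> r y0 powr_mult[of "10 / r" "norm y"] by (simp add: powr_mult powr_powr)
        have "?N powr (e - 1) * k y \<le> ?N powr (e - 1) * (\<Lambda> * norm y powr (- real DIM('a) - \<sigma>))"
          using ku by (intro mult_left_mono) auto
        also have "\<dots> = E * (norm y powr (\<eta> * (e - 1)) * norm y powr (- real DIM('a) - \<sigma>))"
          unfolding N_eq by (simp add: E_def)
        also have "norm y powr (\<eta> * (e - 1)) * norm y powr (- real DIM('a) - \<sigma>) = norm y powr (- real DIM('a) - \<tau>)"
          unfolding powr_add[symmetric] by (simp add: \<tau>_def algebra_simps)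
        finally have "- (E * norm y powr (- real DIM('a) - \<tau>)) \<le> - (?N powr (e - 1)) * k y" by simp
        also have "\<dots> \<le> signed_power e (d y) * k y" using 1 ku by (intro mult_right_mono) auto
        finally show ?thesis using False by (simp add: g_def)
      qed
    qed
    have Ae: "A = (\<lambda>x. x - x1) ` G" by (auto simp: A_def)
    have Am: "A \<in> lmeasurable" "measure lebesgue A = measure lebesgue G"
      unfolding A_def by (rule measurable_translation[OF Gm], rule measure_translation)
    have Ab: "A \<inter> ball 0 (r/4) = {}"
    proof (rule ccontr)
      assume "A \<inter> ball 0 (r/4) \<noteq> {}"
      then obtain z where "z \<in> G" "norm (z - x1) < r/4" by (auto simp: Ae)
      then show False using GS by (auto simp: dist_norm norm_minus_commute)
    qed
    have "\<exists>I. has_principal_value g I \<and> I \<ge> c * measure lebesgue A - C * (E * (r/4) powr (- \<tau>) + D * (r/4) powr \<alpha>)"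
      by (rule C(2)[OF gm _ _ _ bound inner outer Am(1) Ab]) (use r D0 \<Lambda> in \<open>auto simp: D_def E_def\<close>)
    then obtain I where I: "has_principal_value g I" "I \<ge> c * measure lebesgue A - C * (E * (r/4) powr (- \<tau>) + D * (r/4) powr \<alpha>)"
      by blast
    have r4: "(r/4) powr x = r powr x * 4 powr (- x)" for x
      using r by (simp add: powr_divide powr_minus_divide)
    have "E * (r/4) powr (- \<tau>) = E0 * (\<omega> * \<delta>) powr (e - 1) * r powr (- \<sigma>)"
    proof -
      have "(10 / r) powr (\<eta> * (e - 1)) = 10 powr (\<eta> * (e - 1)) * r powr (- (\<eta> * (e - 1)))"
        using r by (simp add: powr_divide powr_minus_divide)
      moreover have "(2 * \<omega> * \<delta>) powr (e - 1) = 2 powr (e - 1) * (\<omega> * \<delta>) powr (e - 1)"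
        using \<omega> \<delta> by (simp add: powr_mult)
      ultimately have "E * (r/4) powr (- \<tau>) = E0 * (\<omega> * \<delta>) powr (e - 1) * (r powr (- (\<eta> * (e - 1))) * r powr (- \<tau>))"
        by (simp add: E_def E0_def r4)
      also have "r powr (- (\<eta> * (e - 1))) * r powr (- \<tau>) = r powr (- \<sigma>)"
        unfolding powr_add[symmetric] by (simp add: \<tau>_def)
      finally show ?thesis .
    qed
    moreover have "D * (r/4) powr \<alpha> \<le> D0 * (\<omega> * \<delta>) powr (e - 1) * r powr (- \<sigma>)"
    proof -
      have "D * (r/4) powr \<alpha> = D0 * (\<kappa> * \<omega>) powr (e - 1) * (r powr (- \<alpha> - \<sigma>) * r powr \<alpha>) * 4 powr (- \<alpha>)"
        by (simp add: D_def r4)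
      also have "r powr (- \<alpha> - \<sigma>) * r powr \<alpha> = r powr (- \<sigma>)"
        unfolding powr_add[symmetric] by simp
      also have "D0 * (\<kappa> * \<omega>) powr (e - 1) * r powr (- \<sigma>) * 4 powr (- \<alpha>) \<le> D0 * (\<kappa> * \<omega>) powr (e - 1) * r powr (- \<sigma>) * 1"
        using D0 \<alpha> powr_mono[of "- \<alpha>" 0 4] by (intro mult_left_mono) auto
      also have "\<dots> \<le> D0 * (\<omega> * \<delta>) powr (e - 1) * r powr (- \<sigma>)"
        using D0 \<kappa> \<omega> e by (simp, intro mult_right_mono mult_left_mono powr_mono2) auto
      finally show ?thesis .
    qed
    ultimately have "E * (r/4) powr (- \<tau>) + D * (r/4) powr \<alpha> \<le> (E0 + D0) * ((\<omega> * \<delta>) powr (e - 1) * r powr (- \<sigma>))"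
      by (simp add: algebra_simps)
    then have "C * (E * (r/4) powr (- \<tau>) + D * (r/4) powr \<alpha>) \<le> C * ((E0 + D0) * ((\<omega> * \<delta>) powr (e - 1) * r powr (- \<sigma>)))"
      using C(1) by (intro mult_left_mono) auto
    then have "I \<ge> c * measure lebesgue G - C * (E0 + D0) * (\<omega> * \<delta>) powr (e - 1) * r powr (- \<sigma>)"
      using I(2) Am(2) by (simp add: mult.assoc)
    then show "\<exists>I. has_phase_value e k (contact_test u x0 x1 r \<omega> \<kappa> b) x1 I \<and>
          I \<ge> \<mu> * (\<omega>/2) powr (e - 1) * (2 * r) powr (- real DIM('a) - \<sigma>) * measure lebesgue G
              - C * (E0 + D0) * (\<omega> * \<delta>) powr (e - 1) * r powr (- \<sigma>)"
      using I(1) unfolding g_def d_def w_def c_def by blast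
  qed
qed

text \<open>
  The positive term comes from the first phase alone. The second phase is bounded below by a multiple
  of \<open>(\<omega> * \<delta>) powr (q - 1) * r powr (- (t * q))\<close>, and \<open>p \<le> q\<close>, \<open>\<omega> \<le> W\<close>, \<open>t * q \<le> s * p\<close> and \<open>r \<le> 1\<close> absorb this
  into the error term of the first phase. The tail exponent \<open>min s t\<close> is admissible for both phases.
\<close>

lemma double_phase_lower_bound:
  fixes p q s t \<Lambda> M W :: real
  assumes \<Lambda>: "\<Lambda> > 0" and st: "0 < s" "s < 1" "0 < t" "t < 1" and pq: "p > 1" "q > 1"
    and p: "p < 2 \<longrightarrow> p > 1 / (1 - s)" and q: "q > 1 / (1 - t)"
    and qp: "p \<le> q" "t * q \<le> s * p" and W: "W > 0"
  obtains c C where "c > 0" "C > 0"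
    "\<And>(Ksp :: (real^'n) \<Rightarrow> (real^'n) \<Rightarrow> real) Ktq a u x0 x1 r \<omega> \<kappa> \<delta> b G.
      admissible_kernel \<Lambda> (s * p) Ksp \<Longrightarrow> admissible_kernel \<Lambda> (t * q) Ktq \<Longrightarrow>
      admissible_coefficient M a \<Longrightarrow>
      good_contact (min s t) u x0 x1 r \<omega> \<kappa> \<delta> b G \<Longrightarrow> r \<le> 1 \<Longrightarrow> \<omega> \<le> W \<Longrightarrow> \<delta> \<le> 1 \<Longrightarrow>
      measure lebesgue (ball x0 r) / 4 \<le> measure lebesgue G \<Longrightarrow>
      \<exists>I J. has_phase_value p (Ksp x1) (contact_test u x0 x1 r \<omega> \<kappa> b) x1 I \<and>
          has_phase_value q (\<lambda>y. a x1 y * Ktq x1 y) (contact_test u x0 x1 r \<omega> \<kappa> b) x1 J \<and>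
          \<omega> powr (p - 1) * r powr (- (s * p)) * (c - C * \<delta> powr (p - 1)) \<le> I + J"
proof -
  let ?\<eta> = "min s t"
  let ?d = "real DIM(real^'n)"
  have pc: "p - 1 > s * p \<or> p \<ge> 2 \<and> s * p < p"
  proof (cases "p < 2")
    case True
    then have "p * (1 - s) > 1" using p st by (simp add: field_simps)
    then show ?thesis by (simp add: algebra_simps)
  qed (use st pq in auto)
  have "q * (1 - t) > 1" using q st by (simp add: field_simps)
  then have qc: "q - 1 > t * q" by (simp add: algebra_simps)
  have \<eta>p: "?\<eta> * (p - 1) < s * p"
  proof -
    have "?\<eta> * (p - 1) \<le> s * (p - 1)" using pq by (intro mult_right_mono) auto
    then show ?thesis using st by (simp add: algebra_simps)
  qed
  have \<eta>q: "?\<eta> * (q - 1) < t * q"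
  proof -
    have "?\<eta> * (q - 1) \<le> t * (q - 1)" using pq by (intro mult_right_mono) auto
    then show ?thesis using st by (simp add: algebra_simps)
  qed
  let ?L = "\<Lambda> * max M 1"
  have L: "?L > 0" using \<Lambda> by simp
  have sp: "s * p > 0" and tq: "t * q > 0" using st pq by auto
  have \<eta>0: "?\<eta> \<ge> 0" using st by simp
  obtain C1 where C1: "C1 > 0" and P1: "\<And>(k :: real^'n \<Rightarrow> real) u x0 x1 r \<omega> \<kappa> \<delta> b G \<mu>.
      k \<in> borel_measurable lebesgue \<Longrightarrow>
      AE y in lebesgue. 0 \<le> k y \<and> k y \<le> \<Lambda> * norm y powr (- ?d - s * p) \<Longrightarrow>
      p - 1 > s * p \<or> (\<forall>y. k (- y) = k y) \<Longrightarrow>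
      \<mu> \<ge> 0 \<Longrightarrow> AE y in lebesgue. \<mu> * norm y powr (- ?d - s * p) \<le> k y \<Longrightarrow>
      good_contact ?\<eta> u x0 x1 r \<omega> \<kappa> \<delta> b G \<Longrightarrow>
      \<exists>I. has_phase_value p k (contact_test u x0 x1 r \<omega> \<kappa> b) x1 I \<and>
          I \<ge> \<mu> * (\<omega>/2) powr (p - 1) * (2 * r) powr (- ?d - s * p) * measure lebesgue G
              - C1 * (\<omega> * \<delta>) powr (p - 1) * r powr (- (s * p))"
    by (rule one_phase_lower_bound[OF pq(1) sp \<Lambda> \<eta>0 \<eta>p pc, where 'a = "real^'n"]) blast
  obtain C2 where C2: "C2 > 0" and P2: "\<And>(k :: real^'n \<Rightarrow> real) u x0 x1 r \<omega> \<kappa> \<delta> b G \<mu>.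
      k \<in> borel_measurable lebesgue \<Longrightarrow>
      AE y in lebesgue. 0 \<le> k y \<and> k y \<le> ?L * norm y powr (- ?d - t * q) \<Longrightarrow>
      q - 1 > t * q \<or> (\<forall>y. k (- y) = k y) \<Longrightarrow>
      \<mu> \<ge> 0 \<Longrightarrow> AE y in lebesgue. \<mu> * norm y powr (- ?d - t * q) \<le> k y \<Longrightarrow>
      good_contact ?\<eta> u x0 x1 r \<omega> \<kappa> \<delta> b G \<Longrightarrow>
      \<exists>I. has_phase_value q k (contact_test u x0 x1 r \<omega> \<kappa> b) x1 I \<and>
          I \<ge> \<mu> * (\<omega>/2) powr (q - 1) * (2 * r) powr (- ?d - t * q) * measure lebesgue G
              - C2 * (\<omega> * \<delta>) powr (q - 1) * r powr (- (t * q))"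
    by (rule one_phase_lower_bound[OF pq(2) tq L \<eta>0 \<eta>q disjI1[OF qc], where 'a = "real^'n"]) blast
  let ?V = "measure lebesgue (ball (0::real^'n) 1)"
  define c where "c = inverse \<Lambda> * (1/2) powr (p - 1) * 2 powr (- ?d - s * p) * (?V / 4)"
  define C where "C = C1 + C2 * W powr (q - p)"
  show ?thesis
  proof (rule that[of c C])
    show "c > 0" using \<Lambda> content_ball_pos[of 1 "0::real^'n"] by (simp add: c_def)
    show "C > 0" using C1 C2 by (simp add: C_def add_pos_nonneg)
    fix Ksp Ktq a :: "(real^'n) \<Rightarrow> (real^'n) \<Rightarrow> real" and u :: "real^'n \<Rightarrow> real"
      and x0 x1 :: "real^'n" and r \<omega> \<kappa> \<delta> b :: real and G :: "(real^'n) set"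
    assume Ks: "admissible_kernel \<Lambda> (s * p) Ksp" and Kt: "admissible_kernel \<Lambda> (t * q) Ktq"
      and a: "admissible_coefficient M a"
      and contact: "good_contact ?\<eta> u x0 x1 r \<omega> \<kappa> \<delta> b G" and le: "r \<le> 1" "\<omega> \<le> W" "\<delta> \<le> 1"
      and G4: "measure lebesgue (ball x0 r) / 4 \<le> measure lebesgue G"
    let ?w = "contact_test u x0 x1 r \<omega> \<kappa> b"
    have r: "0 < r" "r \<le> 1" and \<omega>: "0 < \<omega>" "\<omega> \<le> W" and \<kappa>: "\<kappa> > 0" "\<kappa> \<le> \<delta>" "\<delta> \<le> 1"
      using contact le by (simp_all add: good_contact_def)
    have \<delta>: "\<delta> > 0" using \<kappa> by linarith
    have Ksm: "Ksp x1 \<in> borel_measurable lebesgue" and Ktm: "Ktq x1 \<in> borel_measurable lebesgue"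
      and am: "a x1 \<in> borel_measurable lebesgue" and ab: "AE y in lebesgue. 0 \<le> a x1 y \<and> a x1 y \<le> M"
      using Ks Kt a by (auto simp: admissible_kernel_def admissible_coefficient_def kernel_measurable_def)
    have Ksb: "AE y in lebesgue. 0 \<le> Ksp x1 y \<and> Ksp x1 y \<le> \<Lambda> * norm y powr (- ?d - s * p)"
      using AE_lebesgue_neq[of 0] by eventually_elim (use Ks in \<open>auto simp: admissible_kernel_def less_imp_le\<close>)
    have Ksl: "AE y in lebesgue. inverse \<Lambda> * norm y powr (- ?d - s * p) \<le> Ksp x1 y"
      using AE_lebesgue_neq[of 0] by eventually_elim (use Ks in \<open>auto simp: admissible_kernel_def\<close>)
    have aK: "AE y in lebesgue. 0 \<le> a x1 y * Ktq x1 y \<and> a x1 y * Ktq x1 y \<le> ?L * norm y powr (- ?d - t * q)"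
      using AE_lebesgue_neq[of 0] ab
    proof eventually_elim
      fix y :: "real^'n" assume y: "y \<noteq> 0" "0 \<le> a x1 y \<and> a x1 y \<le> M"
      have K: "0 < Ktq x1 y" "Ktq x1 y \<le> \<Lambda> * norm y powr (- ?d - t * q)"
        using Kt y by (auto simp: admissible_kernel_def)
      have "a x1 y * Ktq x1 y \<le> max M 1 * (\<Lambda> * norm y powr (- ?d - t * q))"
        using y K by (intro mult_mono) auto
      then show "0 \<le> a x1 y * Ktq x1 y \<and> a x1 y * Ktq x1 y \<le> ?L * norm y powr (- ?d - t * q)"
        using y K by (simp add: mult_ac)
    qed
    have "\<exists>I. has_phase_value p (Ksp x1) ?w x1 I \<and>
        I \<ge> inverse \<Lambda> * (\<omega>/2) powr (p - 1) * (2 * r) powr (- ?d - s * p) * measure lebesgue G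
              - C1 * (\<omega> * \<delta>) powr (p - 1) * r powr (- (s * p))"
      by (rule P1[OF Ksm Ksb _ _ Ksl contact])
        (use Ks \<Lambda> in \<open>auto simp: admissible_kernel_def\<close>)
    then obtain I where I: "has_phase_value p (Ksp x1) ?w x1 I"
        "I \<ge> inverse \<Lambda> * (\<omega>/2) powr (p - 1) * (2 * r) powr (- ?d - s * p) * measure lebesgue G
              - C1 * (\<omega> * \<delta>) powr (p - 1) * r powr (- (s * p))" by blast
    have "\<exists>J. has_phase_value q (\<lambda>y. a x1 y * Ktq x1 y) ?w x1 J \<and>
        J \<ge> 0 * (\<omega>/2) powr (q - 1) * (2 * r) powr (- ?d - t * q) * measure lebesgue G
              - C2 * (\<omega> * \<delta>) powr (q - 1) * r powr (- (t * q))"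
      by (rule P2[OF borel_measurable_times[OF am Ktm] aK disjI1[OF qc] _ _ contact])
        (use aK in \<open>auto elim: eventually_mono\<close>)
    then obtain J where J: "has_phase_value q (\<lambda>y. a x1 y * Ktq x1 y) ?w x1 J"
        "J \<ge> - (C2 * (\<omega> * \<delta>) powr (q - 1) * r powr (- (t * q)))" by auto
    let ?S = "\<omega> powr (p - 1) * r powr (- (s * p))"
    have "?S * c \<le> inverse \<Lambda> * (\<omega>/2) powr (p - 1) * (2 * r) powr (- ?d - s * p) * measure lebesgue G"
    proof -
      have "measure lebesgue (ball x0 r) = r powr ?d * ?V"
        using r content_ball_conv_unit_ball[of r x0] by (simp add: powr_realpow)
      moreover have "(\<omega>/2) powr (p - 1) = \<omega> powr (p - 1) * (1/2) powr (p - 1)"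
        using \<omega> powr_mult[of \<omega> "1/2" "p - 1"] by simp
      moreover have "(2 * r) powr (- ?d - s * p) = 2 powr (- ?d - s * p) * r powr (- ?d - s * p)"
        using r by (simp add: powr_mult)
      moreover have "r powr (- (s * p)) = r powr (- ?d - s * p) * r powr ?d"
        unfolding powr_add[symmetric] by simp
      ultimately have "?S * c = inverse \<Lambda> * (\<omega>/2) powr (p - 1) * (2 * r) powr (- ?d - s * p) * (measure lebesgue (ball x0 r) / 4)"
        unfolding c_def by (simp only: mult_ac times_divide_eq_left times_divide_eq_right)
      also have "\<dots> \<le> inverse \<Lambda> * (\<omega>/2) powr (p - 1) * (2 * r) powr (- ?d - s * p) * measure lebesgue G"
        using \<Lambda> G4 by (intro mult_left_mono) auto
      finally show ?thesis .
    qed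
    moreover have "C1 * (\<omega> * \<delta>) powr (p - 1) * r powr (- (s * p)) = ?S * (C1 * \<delta> powr (p - 1))"
      using \<omega> \<delta> by (simp add: powr_mult)
    moreover have "C2 * (\<omega> * \<delta>) powr (q - 1) * r powr (- (t * q)) \<le> ?S * (C2 * W powr (q - p) * \<delta> powr (p - 1))"
    proof -
      have "\<omega> * \<delta> \<le> W * 1" using \<omega> \<kappa> \<delta> by (intro mult_mono) auto
      then have "(\<omega> * \<delta>) powr (q - p) \<le> W powr (q - p)" using \<omega> \<delta> qp by (intro powr_mono2) auto
      then have "(\<omega> * \<delta>) powr (p - 1) * (\<omega> * \<delta>) powr (q - p) \<le> (\<omega> * \<delta>) powr (p - 1) * W powr (q - p)"
        by (intro mult_left_mono) auto
      moreover have "(\<omega> * \<delta>) powr (p - 1) * (\<omega> * \<delta>) powr (q - p) = (\<omega> * \<delta>) powr (q - 1)"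
        unfolding powr_add[symmetric] by simp
      ultimately have 1: "(\<omega> * \<delta>) powr (q - 1) \<le> (\<omega> * \<delta>) powr (p - 1) * W powr (q - p)" by simp
      have 2: "r powr (- (t * q)) \<le> r powr (- (s * p))" using r qp by (intro powr_mono') auto
      have "(\<omega> * \<delta>) powr (q - 1) * r powr (- (t * q)) \<le> ((\<omega> * \<delta>) powr (p - 1) * W powr (q - p)) * r powr (- (s * p))"
        by (intro mult_mono 1 2) auto
      then have "C2 * ((\<omega> * \<delta>) powr (q - 1) * r powr (- (t * q))) \<le> C2 * (((\<omega> * \<delta>) powr (p - 1) * W powr (q - p)) * r powr (- (s * p)))"
        using C2 by (intro mult_left_mono) auto
      then show ?thesis using \<omega> \<delta> by (simp add: powr_mult mult_ac)
    qed
    moreover have "?S * (c - C * \<delta> powr (p - 1)) = ?S * c - ?S * (C1 * \<delta> powr (p - 1)) - ?S * (C2 * W powr (q - p) * \<delta> powr (p - 1))"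
      by (simp add: C_def algebra_simps)
    ultimately have "?S * (c - C * \<delta> powr (p - 1)) \<le> I + J" using I(2) J(2) by linarith
    then show "\<exists>I J. has_phase_value p (Ksp x1) (contact_test u x0 x1 r \<omega> \<kappa> b) x1 I \<and>
          has_phase_value q (\<lambda>y. a x1 y * Ktq x1 y) (contact_test u x0 x1 r \<omega> \<kappa> b) x1 J \<and>
          \<omega> powr (p - 1) * r powr (- (s * p)) * (c - C * \<delta> powr (p - 1)) \<le> I + J"
      using I(1) J(1) by blast
  qed
qed

section \<open>Viscosity inequalities at points of contact\<close>

text \<open>
  The viscosity inequality in the form in which it is used, for test functions at which both principal
  values are finite. It is one-sided, so that \<open>u\<close> and \<open>- u\<close> can be treated alike: a supersolution
  \<open>u\<close> yields this property of \<open>- u\<close>.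
\<close>

definition bounded_at_touching ::
  "real \<Rightarrow> real \<Rightarrow> ((real^'n) \<Rightarrow> (real^'n) \<Rightarrow> real) \<Rightarrow> ((real^'n) \<Rightarrow> (real^'n) \<Rightarrow> real) \<Rightarrow>
   ((real^'n) \<Rightarrow> (real^'n) \<Rightarrow> real) \<Rightarrow> (real^'n) set \<Rightarrow> real \<Rightarrow> ((real^'n) \<Rightarrow> real) \<Rightarrow> bool" where
  "bounded_at_touching p q Ksp Ktq a \<Omega> F u \<longleftrightarrow>
     (\<forall>x0\<in>\<Omega>. \<forall>\<rho>>0. \<forall>\<phi> I J.
        closure (ball x0 \<rho>) \<subseteq> \<Omega> \<and> C2_on (ball x0 \<rho>) \<phi> \<and>
        \<phi> x0 = u x0 \<and> (\<forall>x\<in>ball x0 \<rho>. u x \<le> \<phi> x) \<and>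
        has_phase_value p (Ksp x0) (glue x0 \<rho> \<phi> u) x0 I \<and>
        has_phase_value q (\<lambda>y. a x0 y * Ktq x0 y) (glue x0 \<rho> \<phi> u) x0 J
        \<longrightarrow> I + J \<le> F)"

lemma double_phase_operator_eq:
  assumes "has_phase_value p (Ksp x) w x I" and "has_phase_value q (\<lambda>y. a x y * Ktq x y) w x J"
  shows "double_phase_operator p q Ksp Ktq a w x = ereal (I + J)"
proof -
  have "has_principal_value (\<lambda>y. a x y * signed_power q (w x - w (x + y)) * Ktq x y) J"
    using assms(2) by (simp add: mult_ac)
  then show ?thesis
    using assms(1) by (simp add: double_phase_operator_def pv_integral_eq)
qed

lemma C2_on_minus:
  assumes "C2_on S \<phi>"
  shows "C2_on S (\<lambda>x. - \<phi> x)"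
proof -
  obtain D :: "'a \<Rightarrow> 'a \<Rightarrow>\<^sub>L real" and D2 :: "'a \<Rightarrow> 'a \<Rightarrow>\<^sub>L ('a \<Rightarrow>\<^sub>L real)" where
    D: "\<And>x. x \<in> S \<Longrightarrow> (\<phi> has_derivative blinfun_apply (D x)) (at x)"
    "\<And>x. x \<in> S \<Longrightarrow> (D has_derivative blinfun_apply (D2 x)) (at x)" "continuous_on S D2"
    using assms unfolding C2_on_def by blast
  show ?thesis
    unfolding C2_on_def
  proof (intro exI conjI ballI)
    fix x assume x: "x \<in> S"
    show "((\<lambda>x. - \<phi> x) has_derivative blinfun_apply (- D x)) (at x)"
      using has_derivative_minus[OF D(1)[OF x]] by (simp add: uminus_blinfun.rep_eq fun_Compl_def)
    show "((\<lambda>x. - D x) has_derivative blinfun_apply (- D2 x)) (at x)"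
      using has_derivative_minus[OF D(2)[OF x]] by (simp add: uminus_blinfun.rep_eq fun_Compl_def)
  qed (intro continuous_on_minus D(3))
qed

lemma C2_on_paraboloid: "C2_on S (paraboloid b k x0)"
proof -
  let ?D = "\<lambda>x. (2 * k) *\<^sub>R blinfun_inner_left (x - x0)"
  have bl: "bounded_linear (\<lambda>h. (2 * k) *\<^sub>R (blinfun_inner_left h :: 'a \<Rightarrow>\<^sub>L real))"
    by (intro bounded_linear_const_scaleR bounded_linear_blinfun_inner_left)
  show ?thesis
    unfolding C2_on_def paraboloid_def[abs_def]
  proof (intro exI conjI ballI)
    fix x :: 'a
    show "((\<lambda>x. b + k * (norm (x - x0))\<^sup>2) has_derivative blinfun_apply (?D x)) (at x)"
      unfolding power2_norm_eq_inner
      by (auto intro!: derivative_eq_intros ext simp: blinfun.scaleR_left inner_commute algebra_simps)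
    have "((\<lambda>x. (2 * k) *\<^sub>R (blinfun_inner_left (x - x0) :: 'a \<Rightarrow>\<^sub>L real)) has_derivative
        (\<lambda>h. (2 * k) *\<^sub>R (blinfun_inner_left h :: 'a \<Rightarrow>\<^sub>L real))) (at x)"
      by (rule bounded_linear.has_derivative[OF bl]) (auto intro!: derivative_eq_intros)
    then show "(?D has_derivative blinfun_apply (Blinfun (\<lambda>h. (2 * k) *\<^sub>R (blinfun_inner_left h :: 'a \<Rightarrow>\<^sub>L real)))) (at x)"
      using bl by (simp add: bounded_linear_Blinfun_apply)
  qed (rule continuous_on_const)
qed

lemma subsolution_bounded_at_touching:
  assumes u: "viscosity_subsolution (double_phase_operator p q Ksp Ktq a) \<Omega> f u"
    and f: "\<And>x. x \<in> \<Omega> \<Longrightarrow> f x \<le> F"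
  shows "bounded_at_touching p q Ksp Ktq a \<Omega> F u"
  unfolding bounded_at_touching_def
proof (intro ballI allI impI, elim conjE)
  fix x0 \<rho> \<phi> I J
  assume h: "x0 \<in> \<Omega>" "\<rho> > 0" "closure (ball x0 \<rho>) \<subseteq> \<Omega>" "C2_on (ball x0 \<rho>) \<phi>" "\<phi> x0 = u x0"
    "\<forall>x\<in>ball x0 \<rho>. u x \<le> \<phi> x"
    and I: "has_phase_value p (Ksp x0) (glue x0 \<rho> \<phi> u) x0 I"
    and J: "has_phase_value q (\<lambda>y. a x0 y * Ktq x0 y) (glue x0 \<rho> \<phi> u) x0 J"
  have "double_phase_operator p q Ksp Ktq a (glue x0 \<rho> \<phi> u) x0 \<le> ereal (f x0)"
    using u h unfolding viscosity_subsolution_def by blast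
  then have "I + J \<le> f x0" unfolding double_phase_operator_eq[where w = "glue x0 \<rho> \<phi> u" and x = x0 and Ksp = Ksp and Ktq = Ktq and a = a, OF I J] by simp
  then show "I + J \<le> F" using f[OF h(1)] by linarith
qed

text \<open>
  The operator is odd where its principal values are finite: a function touching \<open>- u\<close> from above is the
  negative of one touching \<open>u\<close> from below.
\<close>

lemma supersolution_bounded_at_touching:
  assumes u: "viscosity_supersolution (double_phase_operator p q Ksp Ktq a) \<Omega> f u"
    and f: "\<And>x. x \<in> \<Omega> \<Longrightarrow> - f x \<le> F"
  shows "bounded_at_touching p q Ksp Ktq a \<Omega> F (\<lambda>x. - u x)"
  unfolding bounded_at_touching_def
proof (intro ballI allI impI, elim conjE)
  fix x0 \<rho> \<phi> I J
  let ?w = "glue x0 \<rho> \<phi> (\<lambda>x. - u x)"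
  assume h: "x0 \<in> \<Omega>" "\<rho> > 0" "closure (ball x0 \<rho>) \<subseteq> \<Omega>" "C2_on (ball x0 \<rho>) \<phi>" "\<phi> x0 = - u x0"
    "\<forall>x\<in>ball x0 \<rho>. - u x \<le> \<phi> x"
    and I: "has_phase_value p (Ksp x0) ?w x0 I"
    and J: "has_phase_value q (\<lambda>y. a x0 y * Ktq x0 y) ?w x0 J"
  let ?v = "glue x0 \<rho> (\<lambda>x. - \<phi> x) u"
  have v: "?v x = - ?w x" for x by (simp add: glue_def)
  have sv: "signed_power e (?v x0 - ?v (x0 + y)) = - signed_power e (?w x0 - ?w (x0 + y))" for e y
    unfolding v signed_power_minus[symmetric] by simp
  have I': "has_phase_value p (Ksp x0) ?v x0 (- I)"
    using has_principal_value_minus[OF I] unfolding sv by simp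
  have J': "has_phase_value q (\<lambda>y. a x0 y * Ktq x0 y) ?v x0 (- J)"
    using has_principal_value_minus[OF J] unfolding sv by simp
  have "\<forall>x\<in>ball x0 \<rho>. - \<phi> x \<le> u x" using h(6) by (auto simp: minus_le_iff)
  then have "double_phase_operator p q Ksp Ktq a ?v x0 \<ge> ereal (f x0)"
    using u h C2_on_minus[OF h(4)] unfolding viscosity_supersolution_def by simp
  then have "f x0 \<le> - I + - J" unfolding double_phase_operator_eq[where w = ?v and x = x0 and Ksp = Ksp and Ktq = Ktq and a = a, OF I' J'] by simp
  then show "I + J \<le> F" using f[OF h(1)] by linarith
qed

section \<open>The growth lemma\<close>

text \<open>
  Young's inequality. It makes the excess \<open>x powr \<eta> - 1\<close> of the tail small with \<open>\<eta>\<close> while fixing the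
  power of \<open>x\<close> in which it is measured.
\<close>

lemma powr_minus_one_le:
  fixes x \<eta> \<eta>0 :: real
  assumes "x \<ge> 1" "0 \<le> \<eta>" "\<eta> \<le> \<eta>0" "\<eta>0 > 0"
  shows "x powr \<eta> - 1 \<le> \<eta> / \<eta>0 * x powr \<eta>0"
proof -
  let ?\<theta> = "\<eta> / \<eta>0"
  have \<theta>: "0 \<le> ?\<theta>" "?\<theta> \<le> 1" using assms by auto
  have "(x powr \<eta>0) powr ?\<theta> * 1 powr (1 - ?\<theta>) \<le> ?\<theta> * x powr \<eta>0 + (1 - ?\<theta>) * 1"
    using \<theta> assms by (intro Youngs_inequality_0) auto
  moreover have "(x powr \<eta>0) powr ?\<theta> = x powr \<eta>" using assms by (simp add: powr_powr)
  ultimately have "x powr \<eta> \<le> ?\<theta> * x powr \<eta>0 + (1 - ?\<theta>)" by simp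
  then show ?thesis using \<theta>(1) by linarith
qed

text \<open>
  Suppose that \<open>u x2\<close> violates the conclusion, with \<open>x2\<close> in \<open>ball x0 (r/2)\<close>, and let \<open>P\<close> be the paraboloid
  of height \<open>\<kappa> * \<omega>\<close>. Since \<open>P\<close> is at most \<open>\<kappa> * \<omega> / 4\<close> at \<open>x2\<close> and at least \<open>9 * \<kappa> * \<omega> / 16\<close> outside
  \<open>cball x0 (3*r/4)\<close>, the maximum of \<open>u - P\<close> over \<open>ball x0 r\<close> is attained at a point \<open>x1\<close> of the latter
  ball. There \<open>u x1\<close> is within \<open>\<kappa> * \<omega> / 2\<close> of the upper bound \<open>m + \<omega>\<close>, so \<open>x1\<close> is a good contact for the set
  \<open>G\<close> where \<open>u \<le> m\<close>, and the lower bound for the operator contradicts the upper bound \<open>F\<close>.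
\<close>

lemma growth_lemma:
  fixes p q s t \<Lambda> M W :: real
  assumes \<Lambda>: "\<Lambda> > 0" and st: "0 < s" "s < 1" "0 < t" "t < 1" and pq: "p > 1" "q > 1"
    and p: "p < 2 \<longrightarrow> p > 1 / (1 - s)" and q: "q > 1 / (1 - t)"
    and qp: "p \<le> q" "t * q \<le> s * p" and W: "W > 0"
  obtains \<epsilon> \<kappa> \<eta>0 where "\<epsilon> > 0" "0 < \<kappa>" "\<kappa> \<le> 1" "\<eta>0 > 0" "\<eta>0 \<le> min s t"
    "\<And>(Ksp :: (real^'n) \<Rightarrow> (real^'n) \<Rightarrow> real) Ktq a u \<Omega> F x0 r \<omega> m \<eta>.
      admissible_kernel \<Lambda> (s * p) Ksp \<Longrightarrow> admissible_kernel \<Lambda> (t * q) Ktq \<Longrightarrow>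
      admissible_coefficient M a \<Longrightarrow>
      u \<in> borel_measurable lebesgue \<Longrightarrow> bounded (range u) \<Longrightarrow>
      continuous_on (ball x0 r) u \<Longrightarrow> cball x0 r \<subseteq> \<Omega> \<Longrightarrow> bounded_at_touching p q Ksp Ktq a \<Omega> F u \<Longrightarrow>
      0 < r \<Longrightarrow> r \<le> 1 \<Longrightarrow> 0 < \<omega> \<Longrightarrow> \<omega> \<le> W \<Longrightarrow> 0 < \<eta> \<Longrightarrow> \<eta> \<le> \<eta>0 \<Longrightarrow>
      F < \<epsilon> * \<omega> powr (p - 1) * r powr (- (s * p)) \<Longrightarrow>
      \<forall>x\<in>ball x0 r. u x \<le> m + \<omega> \<Longrightarrow>
      AE z in lebesgue. z \<notin> ball x0 r \<longrightarrow> u z \<le> m + \<omega> * (2 * (2 * norm (z - x0) / r) powr \<eta> - 1) \<Longrightarrow>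
      measure lebesgue (ball x0 r) / 2 \<le> measure lebesgue {x \<in> ball x0 r. u x \<le> m} \<Longrightarrow>
      \<forall>x\<in>ball x0 (r/2). u x \<le> m + \<omega> * (1 - \<kappa> / 4)"
proof -
  let ?\<eta> = "min s t"
  have \<eta>pos: "?\<eta> > 0" using st by simp
  obtain c C where c: "c > 0" "C > 0" and op:
    "\<And>(Ksp :: (real^'n) \<Rightarrow> (real^'n) \<Rightarrow> real) Ktq a u x0 x1 r \<omega> \<kappa> \<delta> b G.
      admissible_kernel \<Lambda> (s * p) Ksp \<Longrightarrow> admissible_kernel \<Lambda> (t * q) Ktq \<Longrightarrow>
      admissible_coefficient M a \<Longrightarrow>
      good_contact (min s t) u x0 x1 r \<omega> \<kappa> \<delta> b G \<Longrightarrow> r \<le> 1 \<Longrightarrow> \<omega> \<le> W \<Longrightarrow> \<delta> \<le> 1 \<Longrightarrow>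
      measure lebesgue (ball x0 r) / 4 \<le> measure lebesgue G \<Longrightarrow>
      \<exists>I J. has_phase_value p (Ksp x1) (contact_test u x0 x1 r \<omega> \<kappa> b) x1 I \<and>
          has_phase_value q (\<lambda>y. a x1 y * Ktq x1 y) (contact_test u x0 x1 r \<omega> \<kappa> b) x1 J \<and>
          \<omega> powr (p - 1) * r powr (- (s * p)) * (c - C * \<delta> powr (p - 1)) \<le> I + J"
    by (rule double_phase_lower_bound[OF \<Lambda> st pq p q qp W, of M thesis]) blast
  (* The first entry keeps \<kappa> at most 1/4; the second one makes the error C * \<delta> powr (p - 1) at most c/2. *)
  define \<delta> where "\<delta> = min (1/2) ((c / (2 * C)) powr (1 / (p - 1)))"
  have \<delta>: "\<delta> > 0" "\<delta> \<le> 1/2" using c by (auto simp: \<delta>_def)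
  have "\<delta> powr (p - 1) \<le> ((c / (2 * C)) powr (1 / (p - 1))) powr (p - 1)"
    using pq \<delta> by (intro powr_mono2) (auto simp: \<delta>_def)
  also have "\<dots> = c / (2 * C)" using pq c by (simp add: powr_powr)
  finally have "C * \<delta> powr (p - 1) \<le> C * (c / (2 * C))" using c by (intro mult_left_mono) auto
  then have C\<delta>: "c / 2 \<le> c - C * \<delta> powr (p - 1)" using c by simp
  define \<kappa> where "\<kappa> = \<delta> / 2"
  have \<kappa>: "\<kappa> > 0" "\<kappa> \<le> 1/4" using \<delta> by (auto simp: \<kappa>_def)
  (* With this choice the excess of the tail is at most \<delta>/2 times the power in good_contact. *)
  define \<eta>0 where "\<eta>0 = ?\<eta> * \<delta> / 2"
  have \<eta>0: "\<eta>0 > 0" "\<eta>0 \<le> ?\<eta>" using \<eta>pos \<delta> mult_left_mono[of "\<delta> / 2" 1 ?\<eta>] by (auto simp: \<eta>0_def)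
  show ?thesis
  proof (rule that[of "c/2" \<kappa> \<eta>0])
    fix Ksp Ktq a :: "(real^'n) \<Rightarrow> (real^'n) \<Rightarrow> real" and u :: "real^'n \<Rightarrow> real"
      and \<Omega> :: "(real^'n) set" and F :: real and x0 :: "real^'n" and r \<omega> m \<eta> :: real
    assume K: "admissible_kernel \<Lambda> (s * p) Ksp" "admissible_kernel \<Lambda> (t * q) Ktq" "admissible_coefficient M a"
      and um: "u \<in> borel_measurable lebesgue" and ub: "bounded (range u)"
      and cont: "continuous_on (ball x0 r) u" and sub\<Omega>: "cball x0 r \<subseteq> \<Omega>" and bt: "bounded_at_touching p q Ksp Ktq a \<Omega> F u"
      and r: "0 < r" "r \<le> 1" and \<omega>: "0 < \<omega>" "\<omega> \<le> W" and \<eta>: "0 < \<eta>" "\<eta> \<le> \<eta>0"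
      and F: "F < c/2 * \<omega> powr (p - 1) * r powr (- (s * p))"
      and le: "\<forall>x\<in>ball x0 r. u x \<le> m + \<omega>"
      and tail: "AE z in lebesgue. z \<notin> ball x0 r \<longrightarrow> u z \<le> m + \<omega> * (2 * (2 * norm (z - x0) / r) powr \<eta> - 1)"
      and half: "measure lebesgue (ball x0 r) / 2 \<le> measure lebesgue {x \<in> ball x0 r. u x \<le> m}"
    show "\<forall>x\<in>ball x0 (r/2). u x \<le> m + \<omega> * (1 - \<kappa> / 4)"
    proof (rule ccontr)
      assume "\<not> (\<forall>x\<in>ball x0 (r/2). u x \<le> m + \<omega> * (1 - \<kappa> / 4))"
      then obtain x2 where x2: "x2 \<in> ball x0 (r/2)" "u x2 > m + \<omega> * (1 - \<kappa> / 4)" by (auto simp: not_le)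
      define P where "P = (\<lambda>x. \<kappa> * \<omega> / r\<^sup>2 * (norm (x - x0))\<^sup>2)"
      define h where "h = (\<lambda>x. u x - P x)"
      have P_scaled: "P x = \<kappa> * \<omega> * (norm (x - x0) / r)\<^sup>2" for x by (simp add: P_def power_divide)
      have P0: "P x \<ge> 0" for x using \<kappa> \<omega> by (simp add: P_def)
      have P1: "P x \<le> \<kappa> * \<omega>" if "x \<in> ball x0 r" for x
      proof -
        have "(norm (x - x0) / r)\<^sup>2 \<le> 1\<^sup>2" using that r by (intro power_mono) (auto simp: dist_norm norm_minus_commute)
        then show ?thesis unfolding P_scaled using \<kappa> \<omega> by (intro mult_left_le) auto
      qed
      have P2: "P x2 \<le> \<kappa> * \<omega> * (1/4)"
      proof -
        have "(norm (x2 - x0) / r)\<^sup>2 \<le> (1/2)\<^sup>2" using x2 r by (intro power_mono) (auto simp: dist_norm norm_minus_commute)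
        then show ?thesis unfolding P_scaled using \<kappa> \<omega> by (intro mult_left_mono) (auto simp: power2_eq_square)
      qed
      have P3: "P x \<ge> \<kappa> * \<omega> * (9/16)" if "x \<notin> cball x0 (3*r/4)" for x
      proof -
        have "(3/4)\<^sup>2 \<le> (norm (x - x0) / r)\<^sup>2" using that r by (intro power_mono) (auto simp: dist_norm norm_minus_commute field_simps)
        then show ?thesis unfolding P_scaled using \<kappa> \<omega> by (intro mult_left_mono) (auto simp: power2_eq_square)
      qed
      have "continuous_on (cball x0 (3*r/4)) h"
        unfolding h_def P_def using r by (intro continuous_intros continuous_on_subset[OF cont]) auto
      then obtain x1 where x1: "x1 \<in> cball x0 (3*r/4)" "\<forall>x\<in>cball x0 (3*r/4). h x \<le> h x1"
        using continuous_attains_sup[of "cball x0 (3*r/4)" h] r by auto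
      have x1r: "x1 \<in> ball x0 r" using x1 r by auto
      have "x2 \<in> cball x0 (3*r/4)" using x2 r by auto
      then have h21: "h x2 \<le> h x1" using x1(2) by blast
      have hmax: "h x \<le> h x1" if x: "x \<in> ball x0 r" for x
      proof (cases "x \<in> cball x0 (3*r/4)")
        case True
        then show ?thesis using x1(2) by blast
      next
        case False
        have "h x \<le> m + \<omega> - \<kappa> * \<omega> * (9/16)" using le x P3[OF False] unfolding h_def by force
        also have "\<dots> \<le> m + \<omega> * (1 - \<kappa> / 4) - \<kappa> * \<omega> * (1/4)" using \<kappa> \<omega> by (simp add: algebra_simps)
        also have "\<dots> \<le> h x2" using x2 P2 by (simp add: h_def)
        finally show ?thesis using h21 by linarith
      qed
      have ux1: "u x1 \<ge> m + \<omega> * (1 - \<kappa> / 2)"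
        using h21 P0[of x1] x2 P2 by (simp add: h_def algebra_simps)
      have sub: "ball x1 (r/4) \<subseteq> ball x0 r"
      proof
        fix z assume "z \<in> ball x1 (r/4)"
        then show "z \<in> ball x0 r" using x1(1) dist_triangle[of x0 z x1] by simp
      qed
      have "closure (ball x1 (r/4)) \<subseteq> cball x1 (r/4)" by (rule closure_minimal[OF ball_subset_cball closed_cball])
      also have "\<dots> \<subseteq> cball x0 r"
      proof
        fix z assume "z \<in> cball x1 (r/4)"
        then show "z \<in> cball x0 r" using x1(1) dist_triangle[of x0 z x1] by simp
      qed
      finally have closub: "closure (ball x1 (r/4)) \<subseteq> \<Omega>" using sub\<Omega> by blast
      define G where "G = {x \<in> ball x0 r. u x \<le> m} - ball x1 (r/4)"
      have "{x. u x \<le> m} \<in> sets lebesgue"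
        using lebesgue_measurable_vimage_borel[OF um, of "{..m}"] by simp
      then have "ball x0 r \<inter> {x. u x \<le> m} \<in> lmeasurable" by (intro fmeasurable_Int_fmeasurable) auto
      moreover have "{x \<in> ball x0 r. u x \<le> m} = ball x0 r \<inter> {x. u x \<le> m}" by auto
      ultimately have H: "{x \<in> ball x0 r. u x \<le> m} \<in> lmeasurable" by simp
      have Gm: "G \<in> lmeasurable" unfolding G_def by (intro fmeasurable_Diff H) auto
      have Gu: "\<forall>z\<in>G. u x1 - u z \<ge> \<omega> / 2"
      proof
        fix z assume "z \<in> G"
        then have "u x1 - u z \<ge> \<omega> * (1 - \<kappa> / 2)" using ux1 by (simp add: G_def)
        moreover have "\<omega> * (1 - \<kappa> / 2) \<ge> \<omega> * (1/2)" using \<omega> \<kappa> by (intro mult_left_mono) auto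
        ultimately show "u x1 - u z \<ge> \<omega> / 2" by simp
      qed
      (* The ball around x1 takes away at most a quarter of ball x0 r, in every dimension. *)
      have G4: "measure lebesgue (ball x0 r) / 4 \<le> measure lebesgue G"
      proof -
        let ?V = "measure lebesgue (ball (0::real^'n) 1)"
        let ?n = "DIM(real^'n)"
        have n1: "?n \<ge> 1" using DIM_positive[where 'a="real^'n"] by linarith
        have "measure lebesgue (ball x1 (r/4)) = (1/4) ^ ?n * (r ^ ?n * ?V)"
          using r content_ball_conv_unit_ball[of "r/4" x1] by (simp add: power_divide)
        also have "\<dots> \<le> (1/4) ^ 1 * (r ^ ?n * ?V)"
          using r n1 by (intro mult_right_mono power_decreasing) auto
        also have "r ^ ?n * ?V = measure lebesgue (ball x0 r)"
          using r content_ball_conv_unit_ball[of r x0] by simp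
        finally have "measure lebesgue (ball x1 (r/4)) \<le> measure lebesgue (ball x0 r) / 4" by simp
        moreover have "measure lebesgue {x \<in> ball x0 r. u x \<le> m} \<le> measure lebesgue G + measure lebesgue (ball x1 (r/4))"
        proof -
          have "measure lebesgue {x \<in> ball x0 r. u x \<le> m} \<le> measure lebesgue (G \<union> ball x1 (r/4))"
            using H Gm by (intro measure_mono_fmeasurable fmeasurable.Un fmeasurableD) (auto simp: G_def)
          also have "\<dots> \<le> measure lebesgue G + measure lebesgue (ball x1 (r/4))"
            using Gm by (intro measure_Un_le fmeasurableD) auto
          finally show ?thesis .
        qed
        ultimately show ?thesis using half by linarith
      qed
      have far: "AE z in lebesgue. z \<notin> ball x1 (r/4) \<longrightarrow>
          u z - u x1 \<le> 2 * \<omega> * \<delta> * (10 * norm (z - x1) / r) powr ?\<eta>"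
        using tail
      proof (eventually_elim, intro impI)
        fix z assume tz: "z \<notin> ball x0 r \<longrightarrow> u z \<le> m + \<omega> * (2 * (2 * norm (z - x0) / r) powr \<eta> - 1)"
          and z: "z \<notin> ball x1 (r/4)"
        have zr: "r \<le> 4 * norm (z - x1)" using z by (simp add: dist_norm norm_minus_commute)
        have one: "1 \<le> (10 * norm (z - x1) / r) powr ?\<eta>"
          using zr r \<eta>pos by (intro ge_one_powr_ge_zero) (auto simp: field_simps)
        show "u z - u x1 \<le> 2 * \<omega> * \<delta> * (10 * norm (z - x1) / r) powr ?\<eta>"
        proof (cases "z \<in> ball x0 r")
          case True
          have "u z - u x1 \<le> P z" using hmax[OF True] P0[of x1] by (simp add: h_def)
          also have "\<dots> \<le> \<kappa> * \<omega>" by (rule P1[OF True])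
          also have "\<dots> \<le> 2 * \<omega> * \<delta> * 1" using \<omega> \<delta> by (simp add: \<kappa>_def)
          also have "\<dots> \<le> 2 * \<omega> * \<delta> * (10 * norm (z - x1) / r) powr ?\<eta>"
            using one \<omega> \<delta> by (intro mult_left_mono) auto
          finally show ?thesis .
        next
          case False
          let ?\<tau> = "2 * norm (z - x0) / r"
          have \<tau>1: "1 \<le> ?\<tau>" using False r by (simp add: dist_norm norm_minus_commute field_simps)
          have "norm (z - x0) \<le> norm (z - x1) + norm (x1 - x0)"
            using norm_triangle_ineq[of "z - x1" "x1 - x0"] by simp
          also have "\<dots> \<le> 5 * norm (z - x1)" using x1r zr by (simp add: dist_norm norm_minus_commute)
          finally have \<tau>2: "?\<tau> \<le> 10 * norm (z - x1) / r" using r by (intro divide_right_mono) auto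
          let ?T = "(10 * norm (z - x1) / r) powr ?\<eta>"
          have "?\<tau> powr \<eta> - 1 \<le> \<eta> / ?\<eta> * ?\<tau> powr ?\<eta>"
            using \<tau>1 \<eta> \<eta>0 \<eta>pos by (intro powr_minus_one_le) auto
          also have "\<dots> \<le> \<delta> / 2 * ?T"
          proof (intro mult_mono)
            show "\<eta> / ?\<eta> \<le> \<delta> / 2" using \<eta> \<eta>pos by (simp add: \<eta>0_def divide_le_eq mult_ac)
            show "?\<tau> powr ?\<eta> \<le> ?T" using \<tau>1 \<tau>2 \<eta>pos by (intro powr_mono2) auto
          qed (use \<delta> in auto)
          finally have a: "?\<tau> powr \<eta> - 1 \<le> \<delta> / 2 * ?T" .
          have "u z - u x1 \<le> \<omega> * (2 * ?\<tau> powr \<eta> - 1) - \<omega> * (1 - \<kappa> / 2)" using tz False ux1 by simp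
          also have "\<dots> = \<omega> * (2 * (?\<tau> powr \<eta> - 1) + \<kappa> / 2)" by (simp add: algebra_simps)
          also have "\<dots> \<le> \<omega> * (2 * (\<delta> / 2 * ?T) + \<delta> * ?T)"
          proof (intro mult_left_mono add_mono a)
            have "\<kappa> / 2 \<le> \<delta> * 1" using \<delta> by (simp add: \<kappa>_def)
            also have "\<dots> \<le> \<delta> * ?T" using one \<delta> by (intro mult_left_mono) auto
            finally show "\<kappa> / 2 \<le> \<delta> * ?T" .
          qed (use \<omega> in auto)
          finally show ?thesis by (simp add: algebra_simps)
        qed
      qed
      let ?\<phi> = "paraboloid (h x1) (\<kappa> * \<omega> / r\<^sup>2) x0"
      have touch: "u x1 = ?\<phi> x1" by (simp add: h_def P_def paraboloid_def)
      have \<kappa>\<delta>: "\<kappa> \<le> \<delta>" "\<delta> \<le> 1" using \<delta> by (auto simp: \<kappa>_def)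
      have GS: "G \<subseteq> ball x0 r - ball x1 (r/4)" by (auto simp: G_def)
      have contact: "good_contact ?\<eta> u x0 x1 r \<omega> \<kappa> \<delta> (h x1) G"
        unfolding good_contact_def
        by (intro conjI um ub r(1) \<omega>(1) \<kappa>(1) \<kappa>\<delta>(1) x1r touch far Gm GS Gu)
      obtain I J where IJ: "has_phase_value p (Ksp x1) (glue x1 (r/4) ?\<phi> u) x1 I"
          "has_phase_value q (\<lambda>y. a x1 y * Ktq x1 y) (glue x1 (r/4) ?\<phi> u) x1 J"
          "\<omega> powr (p - 1) * r powr (- (s * p)) * (c - C * \<delta> powr (p - 1)) \<le> I + J"
        using op[OF K contact r(2) \<omega>(2) \<kappa>\<delta>(2) G4] unfolding contact_test_def by blast
      have above: "\<forall>x\<in>ball x1 (r/4). u x \<le> ?\<phi> x"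
      proof
        fix x assume "x \<in> ball x1 (r/4)"
        then have "h x \<le> h x1" using sub hmax by blast
        then show "u x \<le> ?\<phi> x" by (simp add: h_def P_def paraboloid_def)
      qed
      have "x1 \<in> \<Omega>" "r/4 > 0" using x1r sub\<Omega> r by auto
      then have "I + J \<le> F"
        using bt[unfolded bounded_at_touching_def, THEN bspec, THEN spec, THEN mp, THEN spec, THEN spec, THEN spec, THEN mp,
          OF _ _ conjI[OF closub conjI[OF C2_on_paraboloid conjI[OF touch[symmetric] conjI[OF above conjI[OF IJ(1,2)]]]]]]
        by blast
      moreover have "\<omega> powr (p - 1) * r powr (- (s * p)) * (c / 2) \<le> \<omega> powr (p - 1) * r powr (- (s * p)) * (c - C * \<delta> powr (p - 1))"
        using C\<delta> by (intro mult_left_mono) auto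
      ultimately show False using F IJ(3) by (simp add: mult_ac)
    qed
  qed (use c \<kappa> \<eta>0 in auto)
qed

section \<open>Oscillation decay and Hoelder continuity\<close>

text \<open>
  Besides the oscillation in the current ball, the induction carries the growth of \<open>u\<close> outside, which
  the step needs as a hypothesis. This growth bound reproduces itself: halving the radius multiplies the
  power by \<open>2 powr \<eta>\<close>, which cancels the factor \<open>2 powr (- \<eta>)\<close> of the amplitude, and the summand \<open>- 1\<close> in it
  leaves room for the shift of the centre, which is at most the decrease of the amplitude.
\<close>

lemma oscillation_decay:
  fixes u :: "'a::euclidean_space \<Rightarrow> real"
  assumes \<eta>: "\<eta> > 0" and \<theta>: "1 - \<theta> / 2 \<le> 2 powr (- \<eta>)" and r0: "r0 > 0" and W: "W > 0"
    and base: "\<forall>x\<in>ball x0 r0. \<bar>u x\<bar> \<le> W" "AE z in lebesgue. \<bar>u z\<bar> \<le> W"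
    and step: "\<And>k m. let r = r0 / 2 ^ k; \<omega> = W * (2 powr (- \<eta>)) ^ k in
      (\<forall>x\<in>ball x0 r. \<bar>u x - m\<bar> \<le> \<omega>) \<longrightarrow>
      (AE z in lebesgue. z \<notin> ball x0 r \<longrightarrow> \<bar>u z - m\<bar> \<le> \<omega> * (2 * (2 * norm (z - x0) / r) powr \<eta> - 1)) \<longrightarrow>
      (\<forall>x\<in>ball x0 (r/2). u x \<le> m + \<omega> * (1 - \<theta>)) \<or> (\<forall>x\<in>ball x0 (r/2). m - \<omega> * (1 - \<theta>) \<le> u x)"
  shows "\<exists>m. \<forall>x\<in>ball x0 (r0 / 2 ^ k). \<bar>u x - m\<bar> \<le> W * (2 powr (- \<eta>)) ^ k"
proof -
  let ?h = "2 powr (- \<eta>) :: real"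
  let ?r = "\<lambda>k. r0 / 2 ^ k"
  let ?\<omega> = "\<lambda>k. W * ?h ^ k"
  have \<omega>: "?\<omega> k > 0" for k using W by simp
  have h1: "?h < 1" using \<eta> by (simp add: powr_less_one)
  have "\<exists>m. (\<forall>x\<in>ball x0 (?r k). \<bar>u x - m\<bar> \<le> ?\<omega> k) \<and>
      (AE z in lebesgue. z \<notin> ball x0 (?r k) \<longrightarrow> \<bar>u z - m\<bar> \<le> ?\<omega> k * (2 * (2 * norm (z - x0) / ?r k) powr \<eta> - 1))"
  proof (induction k)
    case 0
    have "AE z in lebesgue. z \<notin> ball x0 r0 \<longrightarrow> \<bar>u z - 0\<bar> \<le> W * (2 * (2 * norm (z - x0) / r0) powr \<eta> - 1)"
      using base(2)
    proof (eventually_elim, intro impI)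
      fix z assume z: "\<bar>u z\<bar> \<le> W" "z \<notin> ball x0 r0"
      have "1 \<le> (2 * norm (z - x0) / r0) powr \<eta>"
        using z r0 \<eta> by (intro ge_one_powr_ge_zero) (auto simp: dist_norm norm_minus_commute field_simps)
      then have "W * 1 \<le> W * (2 * (2 * norm (z - x0) / r0) powr \<eta> - 1)" using W by (intro mult_left_mono) auto
      then show "\<bar>u z - 0\<bar> \<le> W * (2 * (2 * norm (z - x0) / r0) powr \<eta> - 1)" using z by simp
    qed
    then show ?case using base(1) by (intro exI[of _ 0]) simp
  next
    case (Suc k)
    then obtain m where m: "\<forall>x\<in>ball x0 (?r k). \<bar>u x - m\<bar> \<le> ?\<omega> k"
      "AE z in lebesgue. z \<notin> ball x0 (?r k) \<longrightarrow> \<bar>u z - m\<bar> \<le> ?\<omega> k * (2 * (2 * norm (z - x0) / ?r k) powr \<eta> - 1)"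
      by blast
    have rk: "?r (Suc k) = ?r k / 2" "?r k > 0" using r0 by auto
    have \<omega>k: "?\<omega> (Suc k) = ?h * ?\<omega> k" by simp
    have dec: "?\<omega> (Suc k) \<le> ?\<omega> k" unfolding \<omega>k using h1 \<omega>[of k] by (intro mult_left_le_one_le) auto
    have th: "?\<omega> k * (1 - \<theta> / 2) \<le> ?\<omega> (Suc k)"
      unfolding \<omega>k using \<theta> \<omega>[of k] by (subst mult.commute, intro mult_right_mono) auto
    have sub: "ball x0 (?r k / 2) \<subseteq> ball x0 (?r k)" using rk(2) by (intro subset_ball) simp
    have alt: "(\<forall>x\<in>ball x0 (?r k/2). u x \<le> m + ?\<omega> k * (1 - \<theta>)) \<or> (\<forall>x\<in>ball x0 (?r k/2). m - ?\<omega> k * (1 - \<theta>) \<le> u x)"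
      using step[of k m] m by (simp only: Let_def simp_thms)
    (* The new interval is chosen inside the old one and of half-length exactly ?\<omega> (Suc k), flush with
       the end that was not improved. *)
    have "\<exists>m'. \<bar>m - m'\<bar> \<le> ?\<omega> k - ?\<omega> (Suc k) \<and> (\<forall>x\<in>ball x0 (?r k/2). \<bar>u x - m'\<bar> \<le> ?\<omega> (Suc k))"
      using alt
    proof
      assume a: "\<forall>x\<in>ball x0 (?r k/2). u x \<le> m + ?\<omega> k * (1 - \<theta>)"
      show ?thesis
      proof (intro exI conjI ballI)
        show "\<bar>m - (m - ?\<omega> k + ?\<omega> (Suc k))\<bar> \<le> ?\<omega> k - ?\<omega> (Suc k)" using dec by simp
        fix x assume x: "x \<in> ball x0 (?r k/2)"
        have "\<bar>u x - m\<bar> \<le> ?\<omega> k" "u x \<le> m + ?\<omega> k * (1 - \<theta>)" using a m(1) x sub by blast+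
        then show "\<bar>u x - (m - ?\<omega> k + ?\<omega> (Suc k))\<bar> \<le> ?\<omega> (Suc k)" using th by (simp add: abs_le_iff algebra_simps)
      qed
    next
      assume a: "\<forall>x\<in>ball x0 (?r k/2). m - ?\<omega> k * (1 - \<theta>) \<le> u x"
      show ?thesis
      proof (intro exI conjI ballI)
        show "\<bar>m - (m + ?\<omega> k - ?\<omega> (Suc k))\<bar> \<le> ?\<omega> k - ?\<omega> (Suc k)" using dec by simp
        fix x assume x: "x \<in> ball x0 (?r k/2)"
        have "\<bar>u x - m\<bar> \<le> ?\<omega> k" "m - ?\<omega> k * (1 - \<theta>) \<le> u x" using a m(1) x sub by blast+
        then show "\<bar>u x - (m + ?\<omega> k - ?\<omega> (Suc k))\<bar> \<le> ?\<omega> (Suc k)" using th by (simp add: abs_le_iff algebra_simps)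
      qed
    qed
    then obtain m' where m': "\<bar>m - m'\<bar> \<le> ?\<omega> k - ?\<omega> (Suc k)" "\<forall>x\<in>ball x0 (?r k/2). \<bar>u x - m'\<bar> \<le> ?\<omega> (Suc k)"
      by blast
    have "AE z in lebesgue. z \<notin> ball x0 (?r k/2) \<longrightarrow> \<bar>u z - m'\<bar> \<le> ?\<omega> (Suc k) * (2 * (2 * norm (z - x0) / (?r k/2)) powr \<eta> - 1)"
      using m(2)
    proof (eventually_elim, intro impI)
      fix z assume z: "z \<notin> ball x0 (?r k) \<longrightarrow> \<bar>u z - m\<bar> \<le> ?\<omega> k * (2 * (2 * norm (z - x0) / ?r k) powr \<eta> - 1)"
        and z2: "z \<notin> ball x0 (?r k/2)"
      let ?\<tau> = "2 * norm (z - x0) / ?r k"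
      have \<tau>1: "1 \<le> ?\<tau>" using z2 rk(2) by (simp add: dist_norm norm_minus_commute field_simps)
      have "2 * norm (z - x0) / (?r k/2) = 2 * ?\<tau>" by simp
      then have "?h * (2 * norm (z - x0) / (?r k/2)) powr \<eta> = (?h * 2 powr \<eta>) * ?\<tau> powr \<eta>"
        using \<tau>1 by (simp only: powr_mult mult.assoc)
      also have "?h * 2 powr \<eta> = 1" unfolding powr_add[symmetric] by simp
      finally have ht: "?h * (2 * norm (z - x0) / (?r k/2)) powr \<eta> = ?\<tau> powr \<eta>" by simp
      have "\<bar>u z - m\<bar> \<le> ?\<omega> k * (2 * ?\<tau> powr \<eta> - 1)"
      proof (cases "z \<in> ball x0 (?r k)")
        case True
        have "1 \<le> ?\<tau> powr \<eta>" using \<tau>1 \<eta> by (intro ge_one_powr_ge_zero) auto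
        then have "?\<omega> k * 1 \<le> ?\<omega> k * (2 * ?\<tau> powr \<eta> - 1)" using \<omega>[of k] by (intro mult_left_mono) auto
        then show ?thesis using m(1) True by force
      qed (use z in blast)
      then have "\<bar>u z - m'\<bar> \<le> ?\<omega> k * (2 * ?\<tau> powr \<eta> - 1) + (?\<omega> k - ?\<omega> (Suc k))" using m'(1) by linarith
      also have "\<dots> = ?\<omega> k * (2 * ?\<tau> powr \<eta>) - ?\<omega> (Suc k)" by (simp add: algebra_simps)
      also have "\<dots> = ?\<omega> (Suc k) * (2 * (2 * norm (z - x0) / (?r k/2)) powr \<eta> - 1)"
        unfolding ht[symmetric] by (simp add: algebra_simps)
      finally show "\<bar>u z - m'\<bar> \<le> ?\<omega> (Suc k) * (2 * (2 * norm (z - x0) / (?r k/2)) powr \<eta> - 1)" .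
    qed
    with m'(2) show ?case unfolding rk(1) by blast
  qed
  then show ?thesis by blast
qed

lemma holder_on_of_oscillation_decay:
  fixes u :: "'a::metric_space \<Rightarrow> real"
  assumes \<eta>: "\<eta> > 0" and r0: "r0 > 0" and W: "W > 0" and bd: "\<And>x. x \<in> S \<Longrightarrow> \<bar>u x\<bar> \<le> W"
    and osc: "\<And>x k. x \<in> S \<Longrightarrow> \<exists>m. \<forall>y\<in>ball x (r0 / 2 ^ k). \<bar>u y - m\<bar> \<le> W * (2 powr (- \<eta>)) ^ k"
  shows "holder_on \<eta> S u"
  unfolding holder_on_def
proof (intro exI ballI)
  let ?C = "2 * W * 2 powr \<eta> * r0 powr (- \<eta>)"
  fix x y assume xy: "x \<in> S" "y \<in> S"
  show "\<bar>u x - u y\<bar> \<le> ?C * dist x y powr \<eta>"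
  proof (cases "x = y \<or> dist x y \<ge> r0")
    case True
    show ?thesis
    proof (cases "x = y")
      case False
      have "1 \<le> 2 powr \<eta>" "1 \<le> (dist x y / r0) powr \<eta>"
        using True False r0 \<eta> by (auto intro!: ge_one_powr_ge_zero simp: field_simps)
      then have "1 * 1 \<le> 2 powr \<eta> * (dist x y / r0) powr \<eta>" by (intro mult_mono) auto
      then have "2 * W * 1 \<le> 2 * W * (2 powr \<eta> * (dist x y / r0) powr \<eta>)" using W by (intro mult_left_mono) auto
      also have "\<dots> = ?C * dist x y powr \<eta>" using r0 by (simp add: powr_divide powr_minus_divide)
      finally show ?thesis using bd[OF xy(1)] bd[OF xy(2)] by linarith
    qed (use W in simp)
  next
    case False
    then have d: "0 < dist x y" "dist x y < r0" by auto
    define L where "L = (LEAST k::nat. r0 / 2 ^ k \<le> dist x y)"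
    have "\<exists>k::nat. r0 / dist x y < 2 ^ k" by (rule real_arch_pow) simp
    then have ex: "\<exists>k::nat. r0 / 2 ^ k \<le> dist x y" using d by (auto simp: field_simps intro: less_imp_le)
    have L: "r0 / 2 ^ L \<le> dist x y" unfolding L_def using ex by (rule LeastI_ex)
    have "L \<noteq> 0" using L d by (metis div_by_1 not_less power_0)
    then obtain k where k: "L = Suc k" using not0_implies_Suc by blast
    have "\<not> r0 / 2 ^ k \<le> dist x y" using not_less_Least[of k "\<lambda>k. r0 / 2 ^ k \<le> dist x y"] k L_def by auto
    then have y: "y \<in> ball x (r0 / 2 ^ k)" "x \<in> ball x (r0 / 2 ^ k)" using r0 by auto
    obtain m where "\<forall>y\<in>ball x (r0 / 2 ^ k). \<bar>u y - m\<bar> \<le> W * (2 powr (- \<eta>)) ^ k" using osc[OF xy(1)] by blast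
    then have "\<bar>u x - m\<bar> \<le> W * (2 powr (- \<eta>)) ^ k" "\<bar>u y - m\<bar> \<le> W * (2 powr (- \<eta>)) ^ k" using y by auto
    then have "\<bar>u x - u y\<bar> \<le> 2 * W * (2 powr (- \<eta>)) ^ k" by linarith
    also have "(2 powr (- \<eta>)) ^ k = (1 / 2 ^ k) powr \<eta>"
    proof -
      have "1 / 2 ^ k = 2 powr (- real k)" by (simp add: powr_minus_divide powr_realpow)
      then show ?thesis by (simp add: powr_power powr_powr mult.commute)
    qed
    also have "(1 / 2 ^ k) powr \<eta> \<le> (2 * dist x y / r0) powr \<eta>"
      using L k \<eta> r0 by (intro powr_mono2) (auto simp: field_simps)
    also have "2 * W * (2 * dist x y / r0) powr \<eta> = ?C * dist x y powr \<eta>"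
      using r0 d by (simp add: powr_mult powr_divide powr_minus_divide)
    finally show ?thesis using W by (simp add: mult_left_mono)
  qed
qed

lemma continuous_on_of_semicontinuous:
  assumes "usc_on S u" "lsc_on S u"
  shows "continuous_on S u"
  unfolding continuous_on_def
proof (intro ballI order_tendstoI)
  fix x c assume "x \<in> S"
  then show "c < u x \<Longrightarrow> \<forall>\<^sub>F z in at x within S. c < u z" "u x < c \<Longrightarrow> \<forall>\<^sub>F z in at x within S. u z < c"
    using assms by (auto simp: usc_on_def lsc_on_def)
qed

lemma continuous_AE_le:
  fixes u :: "'a::euclidean_space \<Rightarrow> real"
  assumes S: "open S" and u: "continuous_on S u" and ae: "AE x in lebesgue. \<bar>u x\<bar> \<le> W" and x: "x \<in> S"
  shows "\<bar>u x\<bar> \<le> W"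
proof (rule ccontr)
  assume "\<not> \<bar>u x\<bar> \<le> W"
  then have 1: "x \<in> {x \<in> S. \<bar>u x\<bar> \<in> {W<..}}" using x by auto
  have o: "open (S \<inter> (\<lambda>x. \<bar>u x\<bar>) -` {W<..})"
    by (intro continuous_open_preimage S continuous_intros u open_greaterThan)
  have "AE x in lebesgue. x \<notin> S \<inter> (\<lambda>x. \<bar>u x\<bar>) -` {W<..}" using ae by eventually_elim auto
  then have "S \<inter> (\<lambda>x. \<bar>u x\<bar>) -` {W<..} \<in> null_sets lebesgue"
    using o by (subst AE_iff_null_sets) auto
  then have "negligible (S \<inter> (\<lambda>x. \<bar>u x\<bar>) -` {W<..})" by (simp add: negligible_iff_null_sets)
  then show False using open_not_negligible[OF o] 1 by blast
qed

section \<open>Hoelder continuity of solutions\<close>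

lemma sublevel_or_superlevel_half:
  fixes u :: "'a::euclidean_space \<Rightarrow> real"
  assumes um: "u \<in> borel_measurable lebesgue"
  shows "measure lebesgue (ball x0 r) / 2 \<le> measure lebesgue {x \<in> ball x0 r. u x \<le> m} \<or>
    measure lebesgue (ball x0 r) / 2 \<le> measure lebesgue {x \<in> ball x0 r. m \<le> u x}"
proof -
  have "ball x0 r \<inter> {x. u x \<in> T} \<in> lmeasurable" if "T \<in> sets borel" for T
    using lebesgue_measurable_vimage_borel[OF um that] by (intro fmeasurable_Int_fmeasurable) auto
  from this[of "{..m}"] this[of "{m..}"]
  have L: "{x \<in> ball x0 r. u x \<le> m} \<in> lmeasurable" "{x \<in> ball x0 r. m \<le> u x} \<in> lmeasurable"
    by (simp_all add: Int_def)
  have "{x \<in> ball x0 r. u x \<le> m} \<union> {x \<in> ball x0 r. m \<le> u x} = ball x0 r" by auto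
  with measure_Un_le[OF fmeasurableD[OF L(1)] fmeasurableD[OF L(2)]]
  have "measure lebesgue (ball x0 r) \<le> measure lebesgue {x \<in> ball x0 r. u x \<le> m} + measure lebesgue {x \<in> ball x0 r. m \<le> u x}"
    by (simp only:)
  then show ?thesis by linarith
qed

text \<open>
  Both semicontinuities make \<open>u\<close> continuous, so that the essential bound \<open>U\<close> holds pointwise in the ball
  of radius 2. The exponent depends on \<open>U\<close> through the bound \<open>W\<close> for the amplitudes. The pointwise bound of
  \<open>f\<close>, which may exceed \<open>F\<close>, only determines the initial radius \<open>r0\<close>, hence the Hoelder constant but not
  the exponent.
\<close>

theorem theorem1:
  fixes p q s t \<Lambda> M U F :: real
  assumes "\<Lambda> > 0"
    and "0 < s" "s < 1" "0 < t" "t < 1"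
    and "p > 1" "q > 1"
    and "p < 2 \<longrightarrow> p > 1 / (1 - s)"
    and "q > 1 / (1 - t)"
    and "1 \<le> q / p" "q / p \<le> min (s / t) (1 + s)"
  shows "\<exists>\<gamma>. 0 < \<gamma> \<and> \<gamma> < 1 \<and>
    (\<forall>(Ksp :: (real^'n) \<Rightarrow> (real^'n) \<Rightarrow> real) (Ktq :: (real^'n) \<Rightarrow> (real^'n) \<Rightarrow> real)
       (a :: (real^'n) \<Rightarrow> (real^'n) \<Rightarrow> real) (f :: (real^'n) \<Rightarrow> real) (u :: (real^'n) \<Rightarrow> real).
       admissible_kernel \<Lambda> (s * p) Ksp \<and>
       admissible_kernel \<Lambda> (t * q) Ktq \<and>
       admissible_coefficient M a \<and>
       f \<in> borel_measurable (lebesgue_on (ball 0 2)) \<and>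
       bounded (f ` ball 0 2) \<and>
       Linf_norm (ball 0 2) f = ereal F \<and>
       u \<in> borel_measurable lebesgue \<and>
       bounded (range u) \<and>
       Linf_norm UNIV u = ereal U \<and>
       viscosity_solution (double_phase_operator p q Ksp Ktq a) (ball 0 2) f u \<and>
       finite_double_phase_energy p q s t a u
       \<longrightarrow> holder_on \<gamma> (ball 0 1) u)"
proof -
  define W where "W = max U 1"
  have W: "W > 0" "W \<ge> 1" by (auto simp: W_def)
  have qp: "p \<le> q" "t * q \<le> s * p"
  proof -
    show "p \<le> q" using assms(6,10) by (simp add: le_divide_eq)
    have "q / p \<le> s / t" using assms(11) by simp
    then show "t * q \<le> s * p" using assms(4,6) by (simp add: divide_le_eq le_divide_eq mult_ac)
  qed
  obtain \<epsilon> \<kappa> \<eta>0 where c: "\<epsilon> > 0" "0 < \<kappa>" "\<kappa> \<le> 1" "\<eta>0 > 0" "\<eta>0 \<le> min s t" and growth: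
    "\<And>(Ksp :: (real^'n) \<Rightarrow> (real^'n) \<Rightarrow> real) Ktq a u \<Omega> F x0 r \<omega> m \<eta>.
      admissible_kernel \<Lambda> (s * p) Ksp \<Longrightarrow> admissible_kernel \<Lambda> (t * q) Ktq \<Longrightarrow>
      admissible_coefficient M a \<Longrightarrow>
      u \<in> borel_measurable lebesgue \<Longrightarrow> bounded (range u) \<Longrightarrow>
      continuous_on (ball x0 r) u \<Longrightarrow> cball x0 r \<subseteq> \<Omega> \<Longrightarrow> bounded_at_touching p q Ksp Ktq a \<Omega> F u \<Longrightarrow>
      0 < r \<Longrightarrow> r \<le> 1 \<Longrightarrow> 0 < \<omega> \<Longrightarrow> \<omega> \<le> W \<Longrightarrow> 0 < \<eta> \<Longrightarrow> \<eta> \<le> \<eta>0 \<Longrightarrow>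
      F < \<epsilon> * \<omega> powr (p - 1) * r powr (- (s * p)) \<Longrightarrow>
      \<forall>x\<in>ball x0 r. u x \<le> m + \<omega> \<Longrightarrow>
      AE z in lebesgue. z \<notin> ball x0 r \<longrightarrow> u z \<le> m + \<omega> * (2 * (2 * norm (z - x0) / r) powr \<eta> - 1) \<Longrightarrow>
      measure lebesgue (ball x0 r) / 2 \<le> measure lebesgue {x \<in> ball x0 r. u x \<le> m} \<Longrightarrow>
      \<forall>x\<in>ball x0 (r/2). u x \<le> m + \<omega> * (1 - \<kappa> / 4)"
    by (rule growth_lemma[OF assms(1-9) qp W(1), of M thesis]) blast
  define \<gamma> where "\<gamma> = min \<eta>0 (\<kappa> / 8)"
  have \<gamma>: "0 < \<gamma>" "\<gamma> < 1" "\<gamma> \<le> \<eta>0" using c assms(3) by (auto simp: \<gamma>_def)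
  (* The decay of the amplitudes is no faster than the gain \<kappa>/4 of the growth lemma, shared between
     both ends of the interval, permits. *)
  have h: "1 - (\<kappa> / 4) / 2 \<le> 2 powr (- \<gamma>)"
  proof -
    have "\<gamma> * ln 2 \<le> \<gamma> * 1" using \<gamma> ln_le_minus_one[of 2] by (intro mult_left_mono) auto
    then have "1 - \<gamma> \<le> 1 + (- \<gamma> * ln 2)" by simp
    also have "\<dots> \<le> exp (- \<gamma> * ln 2)" by (rule exp_ge_add_one_self)
    also have "\<dots> = 2 powr (- \<gamma>)" by (simp add: powr_def)
    finally show ?thesis by (simp add: \<gamma>_def min_def split: if_splits)
  qed
  have sp: "s * p > 0" using assms by simp
  have \<gamma>p: "\<gamma> * (p - 1) \<le> s * p"
    using \<gamma> c assms(2,6) by (intro mult_mono) auto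
  show ?thesis
  proof (intro exI[of _ \<gamma>] conjI \<gamma>(1,2) allI impI, elim conjE)
    fix Ksp Ktq a :: "(real^'n) \<Rightarrow> (real^'n) \<Rightarrow> real" and f u :: "(real^'n) \<Rightarrow> real"
    assume K: "admissible_kernel \<Lambda> (s * p) Ksp" "admissible_kernel \<Lambda> (t * q) Ktq" "admissible_coefficient M a"
      and fb: "bounded (f ` ball 0 2)"
      and um: "u \<in> borel_measurable lebesgue" and ub: "bounded (range u)" and uU: "Linf_norm UNIV u = ereal U"
      and vs: "viscosity_solution (double_phase_operator p q Ksp Ktq a) (ball 0 2) f u"
    have sub: "viscosity_subsolution (double_phase_operator p q Ksp Ktq a) (ball 0 2) f u"
      and super: "viscosity_supersolution (double_phase_operator p q Ksp Ktq a) (ball 0 2) f u"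
      using vs by (auto simp: viscosity_solution_def)
    have cont: "continuous_on (ball 0 2) u"
      using sub super by (intro continuous_on_of_semicontinuous) (auto simp: viscosity_subsolution_def viscosity_supersolution_def)
    have "AE x in lebesgue. ereal \<bar>u x\<bar> \<le> esssup lebesgue (\<lambda>x. ereal \<bar>u x\<bar>)" by (rule esssup_AE)
    then have uae: "AE x in lebesgue. \<bar>u x\<bar> \<le> W"
      using uU by (auto simp: Linf_norm_def lebesgue_on_UNIV_eq W_def elim!: eventually_mono)
    have uW: "\<bar>u x\<bar> \<le> W" if "x \<in> ball 0 2" for x
      by (rule continuous_AE_le[OF _ cont uae that]) simp
    obtain B0 where B0: "\<And>x. x \<in> ball 0 2 \<Longrightarrow> \<bar>f x\<bar> \<le> B0" using fb unfolding bounded_iff by (metis imageI real_norm_def)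
    define B where "B = max B0 0"
    have B: "B \<ge> 0" "\<And>x. x \<in> ball 0 2 \<Longrightarrow> f x \<le> B" "\<And>x. x \<in> ball 0 2 \<Longrightarrow> - f x \<le> B"
      using B0 by (fastforce simp: B_def abs_le_iff)+
    have touch: "bounded_at_touching p q Ksp Ktq a (ball 0 2) B u" "bounded_at_touching p q Ksp Ktq a (ball 0 2) B (\<lambda>x. - u x)"
      using subsolution_bounded_at_touching[OF sub B(2)] supersolution_bounded_at_touching[OF super B(3)] by auto
    define r0 where "r0 = min (1/2) (((B + 1) / \<epsilon>) powr (- 1 / (s * p)))"
    have r0: "r0 > 0" "r0 \<le> 1/2" using B c by (auto simp: r0_def)
    have r0B: "B < \<epsilon> * r0 powr (- (s * p))"
    proof -
      have "(((B + 1) / \<epsilon>) powr (- 1 / (s * p))) powr (- (s * p)) \<le> r0 powr (- (s * p))"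
        using r0 sp by (intro powr_mono2') (auto simp: r0_def)
      moreover have "(((B + 1) / \<epsilon>) powr (- 1 / (s * p))) powr (- (s * p)) = (B + 1) / \<epsilon>"
        using assms(2,6) B c by (simp add: powr_powr)
      ultimately have "(B + 1) / \<epsilon> \<le> r0 powr (- (s * p))" by simp
      then have "B + 1 \<le> \<epsilon> * r0 powr (- (s * p))" using c(1) by (simp add: pos_divide_le_eq mult.commute)
      then show ?thesis by linarith
    qed
    (* \<gamma> * (p - 1) \<le> s * p makes the scaling factor of the operator increase along the iteration, so it
       is enough to choose the initial radius small. *)
    have small: "B < \<epsilon> * (W * (2 powr (- \<gamma>)) ^ k) powr (p - 1) * (r0 / 2 ^ k) powr (- (s * p))" for k
    proof -
      have 1: "(W * (2 powr (- \<gamma>)) ^ k) powr (p - 1) = W powr (p - 1) * 2 powr (- (\<gamma> * (p - 1)) * k)"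
        using W by (simp add: powr_mult powr_power powr_powr mult_ac)
      have "r0 / 2 ^ k = r0 * 2 powr (- real k)" by (simp add: powr_minus_divide powr_realpow)
      then have 2: "(r0 / 2 ^ k) powr (- (s * p)) = r0 powr (- (s * p)) * 2 powr (s * p * k)"
        using r0 by (simp add: powr_mult powr_powr mult_ac)
      have 3: "1 \<le> W powr (p - 1)" using W assms(6) by (intro ge_one_powr_ge_zero) auto
      have "1 \<le> 2 powr ((s * p - \<gamma> * (p - 1)) * k)" using \<gamma>p by (intro ge_one_powr_ge_zero) auto
      also have "\<dots> = 2 powr (- (\<gamma> * (p - 1)) * k) * 2 powr (s * p * k)"
        unfolding powr_add[symmetric] by (simp add: algebra_simps)
      finally have 4: "1 * 1 \<le> W powr (p - 1) * (2 powr (- (\<gamma> * (p - 1)) * k) * 2 powr (s * p * k))"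
        using 3 by (intro mult_mono) auto
      have "\<epsilon> * r0 powr (- (s * p)) * 1 \<le> \<epsilon> * r0 powr (- (s * p)) * (W powr (p - 1) * (2 powr (- (\<gamma> * (p - 1)) * k) * 2 powr (s * p * k)))"
        using 4 c by (intro mult_left_mono) auto
      then show ?thesis unfolding 1 2 using r0B by (simp add: mult_ac)
    qed
    show "holder_on \<gamma> (ball 0 1) u"
    proof (rule holder_on_of_oscillation_decay[OF \<gamma>(1) r0(1) W(1)])
      show "\<bar>u x\<bar> \<le> W" if "x \<in> ball 0 1" for x using that by (intro uW) auto
      fix x0 :: "real^'n" and k :: nat assume x0: "x0 \<in> ball 0 1"
      have ball2: "cball x0 1 \<subseteq> ball 0 2"
      proof
        fix z assume "z \<in> cball x0 1"
        then show "z \<in> ball 0 2" using x0 dist_triangle[of 0 z x0] by simp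
      qed
      show "\<exists>m. \<forall>x\<in>ball x0 (r0 / 2 ^ k). \<bar>u x - m\<bar> \<le> W * (2 powr (- \<gamma>)) ^ k"
      proof (rule oscillation_decay[OF \<gamma>(1) h r0(1) W(1) _ uae])
        show "\<forall>x\<in>ball x0 r0. \<bar>u x\<bar> \<le> W" using r0 ball2 by (auto intro!: uW)
        fix k m
        let ?r = "r0 / 2 ^ k" and ?\<omega> = "W * (2 powr (- \<gamma>)) ^ k"
        have "?r \<le> r0" using r0 by (simp add: divide_le_eq)
        then have "?r \<le> 1" using r0(2) by linarith
        with r0(1) have r: "0 < ?r" "?r \<le> 1" by simp_all
        have "2 powr (- \<gamma>) \<le> (1::real)" using \<gamma> powr_mono[of "- \<gamma>" 0 2] by simp
        then have \<omega>: "0 < ?\<omega>" "?\<omega> \<le> W" using W by (auto intro!: mult_left_le power_le_one)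
        have cb: "cball x0 ?r \<subseteq> ball 0 2" using r(2) ball2 subset_cball[OF r(2), of x0] by blast
        have ci: "continuous_on (ball x0 ?r) u" "continuous_on (ball x0 ?r) (\<lambda>x. - u x)"
          using cb by (auto intro!: continuous_on_minus continuous_on_subset[OF cont])
        have um': "(\<lambda>x. - u x) \<in> borel_measurable lebesgue" using um by simp
        have ub': "bounded (range (\<lambda>x. - u x))" using ub by (simp add: bounded_iff)
        have "(\<forall>x\<in>ball x0 (?r/2). u x \<le> m + ?\<omega> * (1 - \<kappa>/4)) \<or> (\<forall>x\<in>ball x0 (?r/2). m - ?\<omega> * (1 - \<kappa>/4) \<le> u x)"
          if near: "\<forall>x\<in>ball x0 ?r. \<bar>u x - m\<bar> \<le> ?\<omega>"
            and far: "AE z in lebesgue. z \<notin> ball x0 ?r \<longrightarrow> \<bar>u z - m\<bar> \<le> ?\<omega> * (2 * (2 * norm (z - x0) / ?r) powr \<gamma> - 1)"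
          using sublevel_or_superlevel_half[OF um, of x0 ?r m]
        proof
          assume half: "measure lebesgue (ball x0 ?r) / 2 \<le> measure lebesgue {x \<in> ball x0 ?r. u x \<le> m}"
          have "\<forall>x\<in>ball x0 ?r. u x \<le> m + ?\<omega>" using near by (auto simp: abs_le_iff algebra_simps)
          moreover have "AE z in lebesgue. z \<notin> ball x0 ?r \<longrightarrow> u z \<le> m + ?\<omega> * (2 * (2 * norm (z - x0) / ?r) powr \<gamma> - 1)"
            using far by eventually_elim linarith
          ultimately have "\<forall>x\<in>ball x0 (?r/2). u x \<le> m + ?\<omega> * (1 - \<kappa>/4)"
            using half by (rule growth[OF K um ub ci(1) cb touch(1) r \<omega> \<gamma>(1,3) small])
          then show ?thesis ..
        next
          assume half: "measure lebesgue (ball x0 ?r) / 2 \<le> measure lebesgue {x \<in> ball x0 ?r. m \<le> u x}"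
          have "\<forall>x\<in>ball x0 ?r. - u x \<le> - m + ?\<omega>" using near by (auto simp: abs_le_iff algebra_simps)
          moreover have "AE z in lebesgue. z \<notin> ball x0 ?r \<longrightarrow> - u z \<le> - m + ?\<omega> * (2 * (2 * norm (z - x0) / ?r) powr \<gamma> - 1)"
            using far by eventually_elim linarith
          moreover have "measure lebesgue (ball x0 ?r) / 2 \<le> measure lebesgue {x \<in> ball x0 ?r. - u x \<le> - m}"
            using half by simp
          ultimately have "\<forall>x\<in>ball x0 (?r/2). - u x \<le> - m + ?\<omega> * (1 - \<kappa>/4)"
            by (rule growth[OF K um' ub' ci(2) cb touch(2) r \<omega> \<gamma>(1,3) small])
          then have "\<forall>x\<in>ball x0 (?r/2). m - ?\<omega> * (1 - \<kappa>/4) \<le> u x" by force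
          then show ?thesis ..
        qed
        then show "let r = r0 / 2 ^ k; \<omega> = W * (2 powr (- \<gamma>)) ^ k in
          (\<forall>x\<in>ball x0 r. \<bar>u x - m\<bar> \<le> \<omega>) \<longrightarrow>
          (AE z in lebesgue. z \<notin> ball x0 r \<longrightarrow> \<bar>u z - m\<bar> \<le> \<omega> * (2 * (2 * norm (z - x0) / r) powr \<gamma> - 1)) \<longrightarrow>
          (\<forall>x\<in>ball x0 (r/2). u x \<le> m + \<omega> * (1 - \<kappa>/4)) \<or> (\<forall>x\<in>ball x0 (r/2). m - \<omega> * (1 - \<kappa>/4) \<le> u x)"
          by (simp only: Let_def) blast
      qed
    qed
  qed
qed

end
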